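(* For all integers $m\ge1$ and $s\ge2$, and every forest $T$ each of whose components is a broom, the $\{T,\overline{mK_s}\}$-free class is $\chi$-bounded by a linear function of $R(s,\omega(G)+1)$; that is, there exists $C=C(T,m,s)\ge1$ such that every graph $G$ that is both $T$-free and $\overline{mK_s}$-free satisfies $\chi(G)\le C\cdot R(s,\omega(G)+1)$.
   Context: Graphs are finite and simple. $\chi(G)$ and $\omega(G)$ denote the chromatic number and clique number of $G$. A graph $G$ is $H$-free if it has no induced subgraph isomorphic to $H$. For $k\ge2$ and $\ell\ge1$, the $(k,\ell)$-broom is the graph obtained from the star $K_{1,\ell+1}$ by subdividing one edge exactly $k-2$ times (so the $(k,1)$-broom is the path on $k+1$ vertices); a broom is a $(k,\ell)$-broom for some integers $k\ge2$, $\ell\ge1$. $\overline{mK_s}$ is the complement of the disjoint union of $m$ copies of $K_s$, i.e. the complete multipartite graph with $m$ parts, each of size $s$. $R(s,w)$ is the Ramsey number: the least integer $n\ge1$ such that every $n$-vertex graph has a stable (independent) set of size $s$ or a clique of size $w$. *)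

theory Defs
  imports Complex_Main "HOL-Library.Ramsey"
begin

text \<open>
  A finite simple graph is a finite vertex set together with a set of two-element subsets of it.
  Cliques and stable sets are the notions \<^const>\<open>clique\<close> and \<^const>\<open>indep\<close> of
  \<^theory>\<open>HOL-Library.Ramsey\<close>, and \<^term>\<open>nsets V 2\<close> is the set of all two-element subsets of \<^term>\<open>V\<close>.
\<close>

datatype 'a graph = Graph (verts: "'a set") (edges: "'a set set")

definition simple_graph :: "'a graph \<Rightarrow> bool" where
  "simple_graph G \<longleftrightarrow> finite (verts G) \<and> edges G \<subseteq> nsets (verts G) 2"

definition induced_subgraph :: "'a graph \<Rightarrow> 'a set \<Rightarrow> 'a graph" where
  "induced_subgraph G S = Graph S {e \<in> edges G. e \<subseteq> S}"

definition graph_isomorphic :: "'a graph \<Rightarrow> 'b graph \<Rightarrow> bool" where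
  "graph_isomorphic G H \<longleftrightarrow>
     (\<exists>f. bij_betw f (verts G) (verts H) \<and>
          (\<forall>u\<in>verts G. \<forall>v\<in>verts G. {u, v} \<in> edges G \<longleftrightarrow> {f u, f v} \<in> edges H))"

definition free_of :: "'a graph \<Rightarrow> 'b graph \<Rightarrow> bool" where
  "free_of G H \<longleftrightarrow> \<not> (\<exists>S \<subseteq> verts G. graph_isomorphic (induced_subgraph G S) H)"

definition complement :: "'a graph \<Rightarrow> 'a graph" where
  "complement G = Graph (verts G) (nsets (verts G) 2 - edges G)"

definition proper_colouring :: "'a graph \<Rightarrow> nat \<Rightarrow> ('a \<Rightarrow> nat) \<Rightarrow> bool" where
  "proper_colouring G k c \<longleftrightarrow>
     (\<forall>v\<in>verts G. c v < k) \<and> (\<forall>u v. {u, v} \<in> edges G \<longrightarrow> c u \<noteq> c v)"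

definition chromatic_number :: "'a graph \<Rightarrow> nat" where
  "chromatic_number G = (LEAST k. \<exists>c. proper_colouring G k c)"

definition clique_number :: "'a graph \<Rightarrow> nat" where
  "clique_number G = Max {card K | K. K \<subseteq> verts G \<and> clique K (edges G)}"

text \<open>Graphs on natural numbers represent all finite graphs up to isomorphism.\<close>

definition ramsey_number :: "nat \<Rightarrow> nat \<Rightarrow> nat" where
  "ramsey_number s w = (LEAST n. n \<ge> 1 \<and>
     (\<forall>G :: nat graph. simple_graph G \<and> card (verts G) = n \<longrightarrow>
        (\<exists>S \<subseteq> verts G. card S = s \<and> indep S (edges G)) \<or>
        (\<exists>K \<subseteq> verts G. card K = w \<and> clique K (edges G))))"

definition path_edges :: "'a list \<Rightarrow> 'a set set" where
  "path_edges xs = {{xs ! i, xs ! Suc i} | i. Suc i < length xs}"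

definition is_cycle :: "'a graph \<Rightarrow> 'a list \<Rightarrow> bool" where
  "is_cycle G xs \<longleftrightarrow> length xs \<ge> 3 \<and> distinct xs \<and> set xs \<subseteq> verts G \<and>
     path_edges xs \<subseteq> edges G \<and> {last xs, hd xs} \<in> edges G"

definition forest :: "'a graph \<Rightarrow> bool" where
  "forest G \<longleftrightarrow> simple_graph G \<and> \<not> (\<exists>xs. is_cycle G xs)"

definition component_of :: "'a graph \<Rightarrow> 'a \<Rightarrow> 'a graph" where
  "component_of G u =
     induced_subgraph G {v \<in> verts G. (u, v) \<in> {(x, y). {x, y} \<in> edges G}\<^sup>*}"

definition components :: "'a graph \<Rightarrow> 'a graph set" where
  "components G = component_of G ` verts G"

text \<open>
  \<open>subdivide_edge G u v ws\<close> subdivides the edge \<open>{u, v}\<close> exactly \<open>length ws\<close> times: it is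
  replaced by a path from \<open>u\<close> to \<open>v\<close> whose successive inner vertices are \<open>ws\<close>. It is meant for
  \<open>{u, v} \<in> edges G\<close> and distinct \<open>ws\<close> outside \<open>verts G\<close>; an empty \<open>ws\<close> leaves the graph unchanged.
\<close>

definition subdivide_edge :: "'a graph \<Rightarrow> 'a \<Rightarrow> 'a \<Rightarrow> 'a list \<Rightarrow> 'a graph" where
  "subdivide_edge G u v ws =
     Graph (verts G \<union> set ws) ((edges G - {{u, v}}) \<union> path_edges (u # ws @ [v]))"

text \<open>The star \<open>K\<^bsub>1,n\<^esub>\<close> with centre \<open>0\<close> and leaves \<open>1, \<dots>, n\<close>.\<close>

definition star :: "nat \<Rightarrow> nat graph" where
  "star n = Graph {0..n} {{0, i} | i. i \<in> {1..n}}"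

text \<open>
  The list \<open>[l + 2..<l + k]\<close> consists of \<open>k - 2\<close> vertices that are new for \<open>star (l + 1)\<close>
  (for \<open>k \<ge> 2\<close>).
\<close>

definition broom :: "nat \<Rightarrow> nat \<Rightarrow> nat graph" where
  "broom k l = subdivide_edge (star (l + 1)) 0 (l + 1) [l + 2..<l + k]"

definition is_broom :: "'a graph \<Rightarrow> bool" where
  "is_broom G \<longleftrightarrow> (\<exists>k l. k \<ge> 2 \<and> l \<ge> 1 \<and> graph_isomorphic G (broom k l))"

text \<open>The disjoint union of \<open>m\<close> copies of the complete graph \<open>K\<^sub>s\<close>; copy \<open>i\<close> lives on \<open>{i} \<times> {..<s}\<close>.\<close>

definition copies_complete :: "nat \<Rightarrow> nat \<Rightarrow> (nat \<times> nat) graph" where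
  "copies_complete m s =
     Graph ({..<m} \<times> {..<s}) (\<Union>i<m. nsets ({i} \<times> {..<s}) 2)"

end

theory Submission
  imports Defs
begin

text \<open>
  Let \<open>M\<close> be a number such that every \<open>M\<close>-set contains a stable \<open>s\<close>-set and such that the common
  neighbourhood of a stable \<open>s\<close>-set is \<open>M\<close>-colourable; by induction on \<open>m\<close>, a constant multiple of
  \<open>R(s, \<omega> + 1)\<close> is such a number. If \<open>K\<close> is not \<open>(s a + M)\<close>-colourable, then fewer than \<open>M\<close> vertices
  are so nearly complete to \<open>K\<close> that their non-neighbours in \<open>K\<close> are \<open>a\<close>-colourable.
  Hence a Gyarfas path can be grown with only additive losses of order \<open>M\<close> and constant factors,
  provided that deleting these few vertices does not cut the path off from \<open>K\<close>.
  This is ensured by keeping \<open>K\<close> inside a set \<open>H\<close> in which no few vertices separate two vertices of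
  \<open>K\<close>; such pairs exist in every graph of large chromatic number by a precolouring argument.
  When the path is long enough, one follows a shortest walk to \<open>K\<close>. The vertices of \<open>K\<close> have large
  degree in \<open>H\<close>, so some vertex of the walk has many private neighbours, and the first such
  vertex is the centre of a broom.
  Much of \<open>K\<close> is anticomplete to this broom, and the next component is found there.
\<close>

section \<open>Colouring and linked sets\<close>

text \<open>A graph is an adjacency relation on the whole type, so passing to an induced subgraph
  only changes the vertex set that is handed to \<open>col\<close>, \<open>conn\<close> or
  \<open>embeds\<close>.\<close>

locale rel_graph =
  fixes E :: "'a \<Rightarrow> 'a \<Rightarrow> bool"
  assumes sym: "E u v \<Longrightarrow> E v u" and irrefl: "\<not> E u u"
begin

definition nb :: "'a \<Rightarrow> 'a set" where
  "nb v = {u. E v u}"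

definition stable :: "'a set \<Rightarrow> bool" where
  "stable S \<longleftrightarrow> (\<forall>u\<in>S. \<forall>v\<in>S. \<not> E u v)"

definition proper :: "'a set \<Rightarrow> nat \<Rightarrow> ('a \<Rightarrow> nat) \<Rightarrow> bool" where
  "proper W n c \<longleftrightarrow> (\<forall>v\<in>W. c v < n) \<and> (\<forall>u\<in>W. \<forall>v\<in>W. E u v \<longrightarrow> c u \<noteq> c v)"

definition col :: "'a set \<Rightarrow> nat \<Rightarrow> bool" where
  "col W n \<longleftrightarrow> (\<exists>c. proper W n c)"

lemma stable_subset: "stable S \<Longrightarrow> T \<subseteq> S \<Longrightarrow> stable T"
  unfolding stable_def by blast

lemma proper_subset: "proper W n c \<Longrightarrow> U \<subseteq> W \<Longrightarrow> proper U n c"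
  unfolding proper_def by blast

lemma col_mono: "col W n \<Longrightarrow> U \<subseteq> W \<Longrightarrow> n \<le> k \<Longrightarrow> col U k"
  unfolding col_def proper_def by (blast intro: order_less_le_trans)

lemma not_col_mono: "\<not> col W n \<Longrightarrow> k \<le> n \<Longrightarrow> \<not> col W k"
  using col_mono by blast

lemma col_Un:
  assumes "col A a" "col B b"
  shows "col (A \<union> B) (a + b)"
proof -
  obtain c d where c: "proper A a c" and d: "proper B b d"
    using assms by (auto simp: col_def)
  have "proper (A \<union> B) (a + b) (\<lambda>v. if v \<in> A then c v else a + d v)"
    using c d unfolding proper_def by (auto simp: trans_less_add1)
  then show ?thesis by (auto simp: col_def)
qed

lemma col_UN:
  assumes "finite I" "\<And>i. i \<in> I \<Longrightarrow> col (A i) n"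
  shows "col (\<Union>i\<in>I. A i) (card I * n)"
  using assms
proof (induction I rule: finite_induct)
  case empty
  then show ?case by (simp add: col_def proper_def)
next
  case (insert i I)
  then have "col (A i \<union> (\<Union>i\<in>I. A i)) (n + card I * n)"
    by (intro col_Un) auto
  then show ?case using insert by simp
qed

lemma col_card:
  assumes "finite W"
  shows "col W (card W)"
proof -
  obtain c where "inj_on c W" "c ` W = {..<card W}"
    using ex_bij_betw_finite_nat[OF assms] unfolding bij_betw_def atLeast0LessThan by blast
  then have "proper W (card W) c"
    unfolding proper_def by (metis imageI inj_onD irrefl lessThan_iff)
  then show ?thesis by (auto simp: col_def)
qed

lemma not_col_Diff:
  assumes "\<not> col W (a + b)" "col B b"
  shows "\<not> col (W - B) a"
  using assms col_mono[OF col_Un[of "W - B" a B b], of W "a + b"] by auto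

lemma not_col_Diff_card:
  assumes "\<not> col W (a + b)" "finite B" "card B \<le> b"
  shows "\<not> col (W - B) a"
  using not_col_Diff[OF assms(1)] col_mono[OF col_card[OF assms(2)] order_refl assms(3)] by blast

lemma not_col_nonempty: "\<not> col W a \<Longrightarrow> W \<noteq> {}"
  by (auto simp: col_def proper_def)

section \<open>Components and sets that few vertices cannot separate\<close>

definition rel :: "'a set \<Rightarrow> ('a \<times> 'a) set" where
  "rel U = {(x, y). x \<in> U \<and> y \<in> U \<and> E x y}"

definition conn :: "'a set \<Rightarrow> bool" where
  "conn U \<longleftrightarrow> (\<forall>x\<in>U. \<forall>y\<in>U. (x, y) \<in> (rel U)\<^sup>*)"

definition component :: "'a set \<Rightarrow> 'a \<Rightarrow> 'a set" where
  "component U x = {y. (x, y) \<in> (rel U)\<^sup>*}"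

text \<open>Only the vertices of \<open>K\<close> must stay together, and the walks between them may
  run through all of \<open>H\<close>. So \<open>K\<close> may even be stable, and \<open>H\<close>
  may have other vertices that are easily cut off.\<close>

definition linked :: "'a set \<Rightarrow> 'a set \<Rightarrow> nat \<Rightarrow> bool" where
  "linked H K k \<longleftrightarrow> K \<subseteq> H \<and>
     (\<forall>S\<subseteq>H. card S < k \<longrightarrow> (\<forall>x\<in>K - S. \<forall>y\<in>K - S. (x, y) \<in> (rel (H - S))\<^sup>*))"

lemma rel_rtrancl_sym: "(x, y) \<in> (rel U)\<^sup>* \<Longrightarrow> (y, x) \<in> (rel U)\<^sup>*"
proof -
  have "sym_on UNIV (rel U)" using sym by (auto simp: rel_def intro: symI)
  then show "(x, y) \<in> (rel U)\<^sup>* \<Longrightarrow> (y, x) \<in> (rel U)\<^sup>*"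
    by (meson sym_rtrancl symE)
qed

lemma rel_rtrancl_mono: "(x, y) \<in> (rel U)\<^sup>* \<Longrightarrow> U \<subseteq> W \<Longrightarrow> (x, y) \<in> (rel W)\<^sup>*"
  by (erule rtrancl_mono[THEN subsetD, rotated]) (auto simp: rel_def)

lemma rel_rtrancl_in: "(x, y) \<in> (rel U)\<^sup>* \<Longrightarrow> x \<in> U \<Longrightarrow> y \<in> U"
  by (induction rule: rtrancl_induct) (auto simp: rel_def)

lemma component_subset: "x \<in> U \<Longrightarrow> component U x \<subseteq> U"
  unfolding component_def using rel_rtrancl_in by blast

lemma component_refl: "x \<in> component U x"
  by (simp add: component_def)

lemma component_closed: "y \<in> component U x \<Longrightarrow> x \<in> U \<Longrightarrow> E y w \<Longrightarrow> w \<in> U \<Longrightarrow> w \<in> component U x"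
proof -
  assume a: "y \<in> component U x" "x \<in> U" "E y w" "w \<in> U"
  then have "y \<in> U" using component_subset by blast
  then have "(y, w) \<in> rel U" using a by (simp add: rel_def)
  then show ?thesis using a unfolding component_def by (simp add: rtrancl.rtrancl_into_rtrancl)
qed

lemma component_rtrancl:
  assumes "x \<in> U" "y \<in> component U x" "(y, w) \<in> (rel U)\<^sup>*"
  shows "(y, w) \<in> (rel (component U x))\<^sup>*"
  using assms(3)
proof (induction rule: rtrancl_induct)
  case base
  then show ?case by simp
next
  case (step v w)
  have "v \<in> component U x" using rel_rtrancl_in[OF step.IH] assms by blast
  moreover have "w \<in> component U x"
    using calculation step(2) assms(1) component_closed by (auto simp: rel_def)
  ultimately have "(v, w) \<in> rel (component U x)" using step(2) by (simp add: rel_def)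
  then show ?case using step.IH by (simp add: rtrancl.rtrancl_into_rtrancl)
qed

lemma conn_component:
  assumes "x \<in> U"
  shows "conn (component U x)"
  unfolding conn_def
proof (intro ballI)
  fix y w assume y: "y \<in> component U x" and w: "w \<in> component U x"
  have "(y, w) \<in> (rel U)\<^sup>*"
    using y w rel_rtrancl_sym unfolding component_def by (metis mem_Collect_eq rtrancl_trans)
  then show "(y, w) \<in> (rel (component U x))\<^sup>*" using component_rtrancl assms y by blast
qed

text \<open>A further set \<open>S'\<close> of fewer than \<open>k\<close> vertices together with
  \<open>S\<close> has fewer than \<open>k + j\<close>, so \<open>H - (S \<union> S')\<close> still
  joins the remaining vertices of \<open>K\<close>, and the joining walk cannot leave the component
  of \<open>x\<close> in \<open>H - S\<close>.\<close>

lemma linked_component: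
  assumes link: "linked H K (k + j)" and "S \<subseteq> H" "finite S" "card S \<le> j" and x: "x \<in> K - S"
    and k: "k \<ge> 1"
  shows "linked (component (H - S) x) (K - S) k"
  unfolding linked_def
proof (intro conjI allI impI ballI)
  have "x \<in> H - S" using link x by (auto simp: linked_def)
  have "card S < k + j" using assms by linarith
  then show sub: "K - S \<subseteq> component (H - S) x"
    using link \<open>S \<subseteq> H\<close> x unfolding linked_def component_def by blast
  fix S' y w
  assume S': "S' \<subseteq> component (H - S) x" "card S' < k" and y: "y \<in> K - S - S'" and w: "w \<in> K - S - S'"
  have "card (S \<union> S') < k + j" using card_Un_le[of S S'] S' assms(4) by linarith
  moreover have "S \<union> S' \<subseteq> H" using S' component_subset[OF \<open>x \<in> H - S\<close>] \<open>S \<subseteq> H\<close> by auto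
  ultimately have r: "(y, w) \<in> (rel (H - (S \<union> S')))\<^sup>*" using link y w unfolding linked_def by blast
  have yH: "y \<in> H - (S \<union> S')" using y link by (auto simp: linked_def)
  have "(y, w) \<in> (rel (component (H - (S \<union> S')) y))\<^sup>*"
    using component_rtrancl[OF yH component_refl r] .
  moreover have "component (H - (S \<union> S')) y \<subseteq> component (H - S) x - S'"
  proof
    fix v assume v: "v \<in> component (H - (S \<union> S')) y"
    then have "v \<notin> S'" using component_subset[OF yH] by auto
    moreover have "(y, v) \<in> (rel (H - S))\<^sup>*"
      using v rel_rtrancl_mono[of y v "H - (S \<union> S')" "H - S"] unfolding component_def by auto
    moreover have "(x, y) \<in> (rel (H - S))\<^sup>*" using sub y by (auto simp: component_def)
    ultimately show "v \<in> component (H - S) x - S'" by (auto simp: component_def)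
  qed
  ultimately show "(y, w) \<in> (rel (component (H - S) x - S'))\<^sup>*" by (rule rel_rtrancl_mono)
qed

text \<open>The colouring is first extended over \<open>A \<union> X\<close>, which misses
  \<open>b\<close>, and then over \<open>B\<close>, which misses \<open>a\<close>. On
  \<open>B\<close> the prescribed set is the separator together with the part of \<open>X\<close>
  beyond it, and \<open>card (A \<inter> B) < k\<close> and \<open>le\<close> keep its size within
  \<open>2 * k\<close>. The two colourings agree on the separator, and no edge joins
  \<open>A - B\<close> to \<open>B - A\<close>.\<close>

lemma extend_across_separation:
  assumes fin: "finite H" and X: "X \<subseteq> H" "card X \<le> 2 * k" and g: "proper X q g"
    and IH: "\<And>H' X' g. H' \<subset> H \<Longrightarrow> X' \<subseteq> H' \<Longrightarrow> card X' \<le> 2 * k \<Longrightarrow> proper X' q g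
        \<Longrightarrow> \<exists>h. proper H' q h \<and> (\<forall>x\<in>X'. h x = g x)"
    and AB: "A \<union> B = H" "\<And>u v. u \<in> A - B \<Longrightarrow> v \<in> B - A \<Longrightarrow> \<not> E u v" "card (A \<inter> B) < k"
    and nA: "a \<in> A - B" and nB: "b \<in> B - A - X" and le: "card (X \<inter> (B - A)) \<le> k"
  shows "\<exists>h. proper H q h \<and> (\<forall>x\<in>X. h x = g x)"
proof -
  have "A \<union> X \<subset> H" using AB X nB by auto
  then obtain h1 where h1: "proper (A \<union> X) q h1" "\<forall>x\<in>X. h1 x = g x"
    using IH[of "A \<union> X" X g] X g by auto
  define Y where "Y = A \<inter> B \<union> X \<inter> (B - A)"
  have "card Y \<le> 2 * k"
    using card_Un_le[of "A \<inter> B" "X \<inter> (B - A)"] AB(3) le unfolding Y_def by linarith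
  moreover have "B \<subset> H" using AB nA by auto
  moreover have "proper Y q h1" using h1(1) by (rule proper_subset) (auto simp: Y_def)
  moreover have "Y \<subseteq> B" by (auto simp: Y_def)
  ultimately obtain h2 where h2: "proper B q h2" "\<forall>x\<in>Y. h2 x = h1 x"
    using IH[of B Y h1] by blast
  define h where "h v = (if v \<in> A then h1 v else h2 v)" for v
  have hB: "h v = h2 v" if "v \<in> B" for v using that h2(2) by (auto simp: h_def Y_def)
  have "\<forall>x\<in>X. h x = g x" using h1(2) h2(2) X AB(1) by (auto simp: h_def Y_def)
  moreover have "proper H q h" unfolding proper_def
  proof (intro conjI ballI impI)
    fix v assume "v \<in> H"
    then show "h v < q" using AB(1) h1(1) h2(1) by (auto simp: h_def proper_def)
  next
    fix u v assume uv: "u \<in> H" "v \<in> H" "E u v"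
    then have "u \<in> A \<and> v \<in> A \<or> u \<in> B \<and> v \<in> B"
      using AB(1,2) sym by blast
    then show "h u \<noteq> h v"
    proof
      assume "u \<in> A \<and> v \<in> A"
      then show ?thesis using h1(1) uv(3) by (auto simp: h_def proper_def)
    next
      assume "u \<in> B \<and> v \<in> B"
      then show ?thesis using h2(1) uv(3) hB by (auto simp: proper_def)
    qed
  qed
  ultimately show ?thesis by blast
qed

text \<open>
  If the extension fails for a smallest \<open>H\<close>, separations of small order have a side inside the
  precoloured set \<open>X\<close>, so \<open>H - X\<close> is linked in \<open>H\<close>.
\<close>

lemma precolouring_extension:
  assumes W: "finite W" and no: "\<And>H K. K \<subseteq> H \<Longrightarrow> H \<subseteq> W \<Longrightarrow> linked H K k \<Longrightarrow> col K c"
    and "H \<subseteq> W" "X \<subseteq> H" "card X \<le> 2 * k" "proper X (c + 2 * k) g"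
  shows "\<exists>h. proper H (c + 2 * k) h \<and> (\<forall>x\<in>X. h x = g x)"
proof -
  have "finite H" using assms by (meson finite_subset)
  then show ?thesis using assms(3-)
  proof (induction H arbitrary: X g rule: finite_psubset_induct)
    case (psubset H)
    have IH: "\<exists>h. proper H' (c + 2 * k) h \<and> (\<forall>x\<in>X'. h x = g x)"
      if "H' \<subset> H" "X' \<subseteq> H'" "card X' \<le> 2 * k" "proper X' (c + 2 * k) g" for H' X' g
      using psubset.IH that psubset.prems(1) by blast
    have finX: "finite X" using psubset by (meson finite_subset)
    show ?case
    proof (cases "col (H - X) c")
      case True
      then obtain d where d: "proper (H - X) c d" by (auto simp: col_def)
      \<comment> \<open>At most \<open>2 * k\<close> of the \<open>c + 2 * k\<close> colours occur
        on \<open>X\<close>, so at least \<open>c\<close> are free, and the colouring of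
        \<open>H - X\<close> can be renamed into them.\<close>
      define F where "F = {..<c + 2 * k} - g ` X"
      have "card (g ` X) \<le> 2 * k" using card_image_le[OF finX, of g] psubset.prems(3) by linarith
      then have "card {..<c} \<le> card F"
        using diff_card_le_card_Diff[of "g ` X" "{..<c + 2 * k}"] finX by (simp add: F_def)
      then obtain i where i: "inj_on i {..<c}" "i ` {..<c} \<subseteq> F"
        using card_le_inj[of "{..<c}" F] by (auto simp: F_def)
      define h where "h v = (if v \<in> X then g v else i (d v))" for v
      have iF: "i (d v) \<in> F" if "v \<in> H - X" for v using that d i(2) by (auto simp: proper_def)
      have "proper H (c + 2 * k) h" unfolding proper_def
      proof (intro conjI ballI impI)
        fix v assume "v \<in> H"
        then show "h v < c + 2 * k"
          using iF[of v] psubset.prems(4) by (auto simp: h_def F_def proper_def)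
      next
        fix u v assume uv: "u \<in> H" "v \<in> H" "E u v"
        consider "u \<in> X" "v \<in> X" | "u \<in> X" "v \<notin> X" | "u \<notin> X" "v \<in> X" | "u \<notin> X" "v \<notin> X" by blast
        then show "h u \<noteq> h v"
        proof cases
          case 1
          then show ?thesis using psubset.prems(4) uv by (auto simp: h_def proper_def)
        next
          case 2
          then have "i (d v) \<notin> g ` X" using iF[of v] uv by (auto simp: F_def)
          with 2 show ?thesis by (auto simp: h_def image_iff)
        next
          case 3
          then have "i (d u) \<notin> g ` X" using iF[of u] uv by (auto simp: F_def)
          with 3 show ?thesis by (auto simp: h_def image_iff)
        next
          case 4
          then have "d u \<noteq> d v" "d u \<in> {..<c}" "d v \<in> {..<c}" using d uv by (auto simp: proper_def)
          with 4 show ?thesis using inj_onD[OF i(1)] by (auto simp: h_def)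
        qed
      qed
      then show ?thesis by (auto simp: h_def)
    next
      case False
      then have "\<not> linked H (H - X) k" using no[of "H - X" H] psubset.prems(1) by auto
      then obtain S x y where S: "S \<subseteq> H" "card S < k" and x: "x \<in> H - X - S" and y: "y \<in> H - X - S"
        and nc: "(x, y) \<notin> (rel (H - S))\<^sup>*"
        unfolding linked_def by blast
      define D where "D = component (H - S) x"
      have DH: "D \<subseteq> H - S" using component_subset[of x "H - S"] x by (auto simp: D_def)
      have xD: "x \<in> D" by (simp add: D_def component_refl)
      have yD: "y \<notin> D" using nc by (simp add: D_def component_def)
      have cl: "\<not> E u v" if "u \<in> D" "v \<in> H - D - S" for u v
        using that component_closed[of u "H - S" x v] x by (auto simp: D_def)
      define A B where "A = D \<union> S" and "B = H - D"
      have AB: "A - B = D" "B - A = H - D - S" "A \<inter> B = S" "A \<union> B = H"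
        using DH S(1) by (auto simp: A_def B_def)
      have "X \<inter> D \<inter> (X \<inter> (H - D - S)) = {}" by auto
      then have "card (X \<inter> D) + card (X \<inter> (H - D - S)) = card (X \<inter> D \<union> X \<inter> (H - D - S))"
        using finX by (simp add: card_Un_disjoint)
      also have "\<dots> \<le> card X" using finX by (intro card_mono) auto
      \<comment> \<open>Some side of the separation has at most \<open>k\<close> precoloured
        vertices and can be coloured last, in the role of \<open>B\<close>. Both sides have a vertex
        outside \<open>X\<close>, namely \<open>x\<close> and \<open>y\<close>, so either order of
        the sides is possible.\<close>
      finally have "card (X \<inter> D) \<le> k \<or> card (X \<inter> (H - D - S)) \<le> k"
        using psubset.prems(3) by linarith
      then show ?thesis
      proof
        assume le: "card (X \<inter> (H - D - S)) \<le> k"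
        show ?thesis
        proof (rule extend_across_separation[OF psubset.hyps(1) psubset.prems(2,3,4) IH])
          show "A \<union> B = H" "card (A \<inter> B) < k" "x \<in> A - B" "y \<in> B - A - X"
            "card (X \<inter> (B - A)) \<le> k"
            using AB S(2) xD x y yD le by simp_all
          show "\<not> E u v" if "u \<in> A - B" "v \<in> B - A" for u v using cl that AB by metis
        qed
      next
        assume le: "card (X \<inter> D) \<le> k"
        show ?thesis
        proof (rule extend_across_separation[OF psubset.hyps(1) psubset.prems(2,3,4) IH])
          show "B \<union> A = H" "card (B \<inter> A) < k"
            using AB(3,4) S(2) by (simp_all add: Int_commute Un_commute)
          show "y \<in> B - A" "x \<in> A - B - X" "card (X \<inter> (A - B)) \<le> k"
            using AB(1,2) xD x y yD le by simp_all
          show "\<not> E u v" if "u \<in> B - A" "v \<in> A - B" for u v using cl that AB sym by metis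
        qed
      qed
    qed
  qed
qed

text \<open>The contrapositive of \<open>precolouring_extension\<close> with nothing
  precoloured.\<close>

lemma linked_subset_exists:
  assumes "finite W" "\<not> col W (c + 2 * k)"
  obtains H K where "K \<subseteq> H" "H \<subseteq> W" "linked H K k" "\<not> col K c"
proof (rule ccontr)
  assume "\<not> thesis"
  then have no: "\<And>H K. K \<subseteq> H \<Longrightarrow> H \<subseteq> W \<Longrightarrow> linked H K k \<Longrightarrow> col K c" using that by blast
  have "\<exists>h. proper W (c + 2 * k) h \<and> (\<forall>x\<in>{}. h x = undefined x)"
    by (rule precolouring_extension[OF assms(1) no]) (auto simp: proper_def)
  then have "col W (c + 2 * k)" by (auto simp: col_def)
  then show False using assms(2) by blast
qed

end

section \<open>Induced paths into linked sets\<close>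

context rel_graph begin

text \<open>A repetition, a chord, an early neighbour in \<open>T\<close> or an early common
  neighbour with the end would give a shorter walk to \<open>T\<close>. The last two bounds tell
  which vertices of the walk can be close to \<open>T\<close> or to the end.\<close>

lemma shortest_walk:
  assumes zT: "z \<notin> T" and x: "x \<in> U" "E z x" "(x, t) \<in> (rel U)\<^sup>*" "t \<in> T"
  obtains n f where "f 0 = z" "n \<ge> 1" "f n \<in> T"
    "\<And>i. 1 \<le> i \<Longrightarrow> i \<le> n \<Longrightarrow> f i \<in> U" "\<And>i. i < n \<Longrightarrow> f i \<notin> T"
    "\<And>i. i < n \<Longrightarrow> E (f i) (f (Suc i))"
    "\<And>i j. i < j \<Longrightarrow> j \<le> n \<Longrightarrow> f i \<noteq> f j"
    "\<And>i j. i < j \<Longrightarrow> j \<le> n \<Longrightarrow> E (f i) (f j) \<Longrightarrow> j = Suc i"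
    "\<And>i w. i \<le> n \<Longrightarrow> w \<in> T \<Longrightarrow> w \<in> U \<Longrightarrow> E (f i) w \<Longrightarrow> n \<le> i + 1"
    "\<And>i w. i \<le> n \<Longrightarrow> w \<in> U \<Longrightarrow> E (f i) w \<Longrightarrow> E w (f n) \<Longrightarrow> n \<le> i + 2"
proof -
  \<comment> \<open>Only the second vertex of a pair must lie in \<open>U\<close>, since the start
    \<open>z\<close> may lie outside.\<close>
  define r where "r = {(x, y). y \<in> U \<and> E x y}"
  have "(rel U)\<^sup>* \<subseteq> r\<^sup>*" by (rule rtrancl_mono) (auto simp: rel_def r_def)
  moreover have "(z, x) \<in> r" using x by (simp add: r_def)
  ultimately have "(z, t) \<in> r\<^sup>*" using x(3) by (meson converse_rtrancl_into_rtrancl subsetD)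
  then have ex: "\<exists>n. \<exists>t\<in>T. (z, t) \<in> r ^^ n" using x(4) rtrancl_imp_relpow by blast
  define n where "n = (LEAST n. \<exists>t\<in>T. (z, t) \<in> r ^^ n)"
  obtain u where u: "u \<in> T" "(z, u) \<in> r ^^ n" using LeastI_ex[OF ex] by (auto simp: n_def)
  have least: "n \<le> i" if "v \<in> T" "(z, v) \<in> r ^^ i" for v i
    unfolding n_def by (rule Least_le) (use that in blast)
  obtain f where f: "f 0 = z" "f n = u" "\<And>i. i < n \<Longrightarrow> (f i, f (Suc i)) \<in> r"
    using u(2) by (auto simp: relpow_fun_conv)
  have seg: "(f i, f (i + d)) \<in> r ^^ d" if "i + d \<le> n" for i d
    unfolding relpow_fun_conv by (rule exI[of _ "\<lambda>m. f (i + m)"]) (use f(3) that in auto)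
  have start: "(z, f i) \<in> r ^^ i" if "i \<le> n" for i using seg[of 0 i] that f(1) by simp
  have cat: "(y, v) \<in> r ^^ (i + j)" if "(y, w) \<in> r ^^ i" "(w, v) \<in> r ^^ j" for y w v i j
    using that by (auto simp: relpow_add)
  have fU: "f i \<in> U" if "1 \<le> i" "i \<le> n" for i
    using f(3)[of "i - 1"] that by (auto simp: r_def)
  show thesis
  proof (rule that[of f n])
    show "f 0 = z" "f n \<in> T" using f u by simp_all
    show "n \<ge> 1" using f u zT by (cases n) auto
    show "f i \<in> U" if "1 \<le> i" "i \<le> n" for i using fU that .
    show "f i \<notin> T" if "i < n" for i using least[of "f i" i] start[of i] that by (metis less_imp_le linorder_not_less)
    show "E (f i) (f (Suc i))" if "i < n" for i using f(3)[OF that] by (simp add: r_def)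
    show "f i \<noteq> f j" if "i < j" "j \<le> n" for i j
    proof
      assume eq: "f i = f j"
      have "(f j, f n) \<in> r ^^ (n - j)" using seg[of j "n - j"] that by simp
      then have "(f i, u) \<in> r ^^ (n - j)" using eq f(2) by simp
      then have "(z, u) \<in> r ^^ (i + (n - j))" by (rule cat[rotated]) (use start[of i] that in simp)
      then show False using least[OF u(1)] that by fastforce
    qed
    show "j = Suc i" if "i < j" "j \<le> n" "E (f i) (f j)" for i j
    proof -
      have "(f i, f j) \<in> r ^^ 1" using that fU[of j] by (auto simp: r_def)
      moreover have "(f j, f n) \<in> r ^^ (n - j)" using seg[of j "n - j"] that by simp
      ultimately have "(z, u) \<in> r ^^ (i + 1 + (n - j))"
        using cat[OF cat[OF start[of i]], of "f j" 1 u "n - j"] that f(2) by simp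
      then show ?thesis using least[OF u(1)] that by fastforce
    qed
    show "n \<le> i + 1" if "i \<le> n" "w \<in> T" "w \<in> U" "E (f i) w" for i w
    proof -
      have "(f i, w) \<in> r ^^ 1" using that by (auto simp: r_def)
      then have "(z, w) \<in> r ^^ (i + 1)" by (rule cat[OF start[OF that(1)]])
      then show ?thesis using least that(2) by blast
    qed
    show "n \<le> i + 2" if "i \<le> n" "w \<in> U" "E (f i) w" "E w (f n)" for i w
    proof (cases "n = 0")
      case False
      then have "f n \<in> U" using fU by simp
      then have "(f i, w) \<in> r ^^ 1" "(w, f n) \<in> r ^^ 1" using that by (auto simp: r_def)
      then have "(f i, f n) \<in> r ^^ (1 + 1)" by (rule cat)
      then have "(z, u) \<in> r ^^ (i + (1 + 1))" using cat[OF start[OF that(1)]] f(2) by blast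
      then show ?thesis using least[OF u(1)] by fastforce
    qed simp
  qed
qed

section \<open>Induced paths as lists\<close>

text \<open>The head is the end at which the path grows, so an extension only has to check the new
  vertex. For \<open>xs = []\<close> the last condition is vacuous, so the unspecified
  \<open>hd []\<close> does no harm.\<close>

fun ipath :: "'a list \<Rightarrow> bool" where
  "ipath [] \<longleftrightarrow> True"
| "ipath (x # xs) \<longleftrightarrow> x \<notin> set xs \<and> ipath xs \<and> (\<forall>y\<in>set xs. E x y \<longleftrightarrow> y = hd xs)"

lemma ipath_take: "ipath xs \<Longrightarrow> ipath (take k xs)"
proof (induction xs arbitrary: k)
  case (Cons x xs)
  show ?case
  proof (cases k)
    case (Suc j)
    have "hd (take j xs) = hd xs" if "take j xs \<noteq> []" using that by (cases j) (auto simp: hd_take)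
    then have "\<forall>y\<in>set (take j xs). E x y \<longleftrightarrow> y = hd (take j xs)"
      using Cons.prems by (metis empty_iff in_set_takeD ipath.simps(2) list.set(1))
    then show ?thesis using Cons Suc by (auto dest: in_set_takeD)
  qed simp
qed simp

lemma ipath_distinct: "ipath xs \<Longrightarrow> distinct xs"
  by (induction xs) auto

lemma ipath_nth:
  "ipath xs \<Longrightarrow> i < length xs \<Longrightarrow> j < length xs \<Longrightarrow> E (xs ! i) (xs ! j) \<longleftrightarrow> i = Suc j \<or> j = Suc i"
proof (induction xs arbitrary: i j)
  case (Cons x xs)
  have hd: "E x (xs ! m) \<longleftrightarrow> m = 0" if "m < length xs" for m
  proof -
    have "xs ! m = hd xs \<longleftrightarrow> m = 0"
      using that Cons.prems(1) ipath_distinct[of xs] nth_eq_iff_index_eq[of xs m 0] by (cases xs) auto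
    then show ?thesis using Cons.prems(1) that by auto
  qed
  show ?case
  proof (cases i; cases j)
    fix i' j' assume "i = Suc i'" "j = Suc j'"
    then show ?thesis using Cons by auto
  next
    fix j' assume "i = 0" "j = Suc j'"
    then show ?thesis using Cons.prems hd[of j'] by auto
  next
    fix i' assume "i = Suc i'" "j = 0"
    then show ?thesis
      using Cons.prems hd[of i'] sym[of "xs ! i'" x] sym[of x "xs ! i'"] by auto
  next
    assume "i = 0" "j = 0"
    then show ?thesis using irrefl by auto
  qed
qed simp

text \<open>The walk is reversed, so that its far end becomes the new head, and
  \<open>f 0 = z\<close> is the vertex shared with the old path. All initial segments are covered,
  because a broom uses only the segment up to its centre.\<close>

lemma ipath_append_walk:
  assumes "ipath (z # rest)" "f 0 = z"
    and inj: "\<And>i j. i < j \<Longrightarrow> j \<le> n \<Longrightarrow> f i \<noteq> f j"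
    and walk: "\<And>i. i < n \<Longrightarrow> E (f i) (f (Suc i))"
    and ind: "\<And>i j. i < j \<Longrightarrow> j \<le> n \<Longrightarrow> E (f i) (f j) \<Longrightarrow> j = Suc i"
    and rest: "\<And>i. 1 \<le> i \<Longrightarrow> i \<le> n \<Longrightarrow> f i \<notin> set rest \<and> (\<forall>y\<in>set rest. \<not> E y (f i))"
    and "j \<le> n"
  shows "ipath (map f (rev [0..<Suc j]) @ rest)"
  using \<open>j \<le> n\<close>
proof (induction j)
  case 0
  then show ?case using assms by simp
next
  case (Suc j)
  have eq: "map f (rev [0..<Suc (Suc j)]) @ rest = f (Suc j) # (map f (rev [0..<Suc j]) @ rest)" by simp
  have set_eq: "set (map f (rev [0..<Suc j]) @ rest) = f ` {..j} \<union> set rest"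
    by (simp only: set_append set_map set_rev set_upt) (simp add: atLeast0LessThan lessThan_Suc_atMost)
  have "f (Suc j) \<notin> set (map f (rev [0..<Suc j]) @ rest)"
  proof -
    have "f (Suc j) \<notin> f ` {..j}"
    proof
      assume "f (Suc j) \<in> f ` {..j}"
      then obtain i where "i \<le> j" "f i = f (Suc j)" by auto
      then show False using inj[of i "Suc j"] Suc.prems by simp
    qed
    then show ?thesis using rest[of "Suc j"] Suc.prems unfolding set_eq by simp
  qed
  moreover have "E (f (Suc j)) y \<longleftrightarrow> y = f j" if y: "y \<in> set (map f (rev [0..<Suc j]) @ rest)" for y
  proof -
    consider i where "i \<le> j" "y = f i" | "y \<in> set rest" using y unfolding set_eq by auto
    then show ?thesis
    proof cases
      case 1
      show ?thesis
      proof (cases "i = j")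
        case True
        then show ?thesis using walk[of j] Suc.prems sym[of "f j" "f (Suc j)"] 1 by auto
      next
        case False
        then have "\<not> E (f (Suc j)) (f i)" "f i \<noteq> f j"
            using ind[of i "Suc j"] inj[of i j] 1 Suc.prems sym[of "f (Suc j)" "f i"] by auto
          then show ?thesis using 1 by simp
      qed
    next
      case 2
      have "y \<noteq> f j"
      proof (cases "j = 0")
        case True
        then show ?thesis using 2 assms(1,2) by auto
      next
        case False
        then show ?thesis using rest[of j] 2 Suc.prems by auto
      qed
      then show ?thesis using rest[of "Suc j"] 2 Suc.prems sym[of "f (Suc j)" y] by auto
    qed
  qed
  ultimately show ?case unfolding eq using Suc by simp
qed

text \<open>
  The last condition keeps every vertex of \<open>H\<close> usable as the next head, and linkedness lets the path
  avoid the vertices that are nearly complete to a smaller target.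
\<close>

definition gstate :: "'a set \<Rightarrow> 'a list \<Rightarrow> 'a set \<Rightarrow> 'a set \<Rightarrow> nat \<Rightarrow> nat \<Rightarrow> bool" where
  "gstate W xs H K a l \<longleftrightarrow> xs \<noteq> [] \<and> ipath xs \<and> set xs \<subseteq> W \<and> H \<subseteq> W \<and> set xs \<inter> H = {} \<and>
     conn H \<and> (\<exists>w\<in>H. E (hd xs) w) \<and> (\<forall>x\<in>set (tl xs). \<forall>w\<in>H. \<not> E x w) \<and>
     linked H K l \<and> (\<forall>v\<in>insert (hd xs) H. \<not> col (K - nb v) a)"

lemma rtrancl_enters:
  assumes "(w, v) \<in> r\<^sup>*" "w \<notin> L" "v \<in> L"
  shows "\<exists>t v'. (w, t) \<in> r\<^sup>* \<and> t \<notin> L \<and> v' \<in> L \<and> (t, v') \<in> r"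
  using assms by (induction rule: rtrancl_induct) auto

text \<open>The head moves inside \<open>U\<close> along a shortest walk to the outer boundary
  \<open>T\<close> of \<open>L\<close>. The end of this walk is the first vertex with a neighbour in
  \<open>L\<close>, so it can be the new head, and all earlier vertices of the path are anticomplete
  to \<open>L\<close>.\<close>

lemma gstate_advance:
  assumes st: "gstate W xs H K a l" and U: "U \<subseteq> H" "conn U" "w \<in> U" "E (hd xs) w"
    and L: "L \<subseteq> U" "L \<noteq> {}" "conn L" "linked L K' l'" "\<And>u. u \<in> L \<Longrightarrow> \<not> E (hd xs) u"
    and nh: "\<And>v. v \<in> U \<Longrightarrow> \<not> col (K' - nb v) a'"
  shows "\<exists>ys. length xs < length ys \<and> gstate W ys L K' a' l'"
proof -
  define z where "z = hd xs"
  have xs: "xs = z # tl xs" using st by (simp add: gstate_def z_def)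
  have zH: "z \<in> W" "z \<notin> H" using st hd_in_set[of xs] unfolding gstate_def z_def by blast+
  have tlH: "\<not> E y u" "y \<noteq> u" if "y \<in> set (tl xs)" "u \<in> H" for y u
    using that st list.set_sel(2)[of xs y] by (auto simp: gstate_def)
  define T where "T = {u \<in> U - L. \<exists>v\<in>L. E u v}"
  obtain v where v: "v \<in> L" using L(2) by blast
  have "(w, v) \<in> (rel U)\<^sup>*" using U L(1) v by (auto simp: conn_def)
  moreover have "w \<notin> L" using L(5) U(4) by blast
  ultimately obtain t v' where t: "(w, t) \<in> (rel U)\<^sup>*" "t \<notin> L" "v' \<in> L" "(t, v') \<in> rel U"
    using rtrancl_enters[of w v "rel U" L] v by blast
  have tT: "t \<in> T" using t by (auto simp: T_def rel_def)
  have zT: "z \<notin> T" using zH U(1) by (auto simp: T_def)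
  obtain n f where f: "f 0 = z" "n \<ge> 1" "f n \<in> T" and fU: "\<And>i. 1 \<le> i \<Longrightarrow> i \<le> n \<Longrightarrow> f i \<in> U"
    and fT: "\<And>i. i < n \<Longrightarrow> f i \<notin> T"
    and walk: "\<And>i. i < n \<Longrightarrow> E (f i) (f (Suc i))"
    and inj: "\<And>i j. i < j \<Longrightarrow> j \<le> n \<Longrightarrow> f i \<noteq> f j"
    and ind: "\<And>i j. i < j \<Longrightarrow> j \<le> n \<Longrightarrow> E (f i) (f j) \<Longrightarrow> j = Suc i"
    by (rule shortest_walk[OF zT U(3) U(4)[folded z_def] t(1) tT]) (rule that)
  \<comment> \<open>The walk cannot enter \<open>L\<close> without passing through \<open>T\<close>
    first: the old head has no neighbour in \<open>L\<close>, and a later vertex outside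
    \<open>L\<close> that has one lies in \<open>T\<close>.\<close>
  have fL: "f i \<notin> L" if "i \<le> n" for i
    using that
  proof (induction i)
    case 0
    then show ?case using f(1) zH L(1) U(1) by auto
  next
    case (Suc i)
    show ?case
    proof
      assume a: "f (Suc i) \<in> L"
      have e: "E (f i) (f (Suc i))" using walk Suc.prems by simp
      show False
      proof (cases "i = 0")
        case True
        then show ?thesis using e f(1) a L(5) z_def by auto
      next
        case False
        then have "f i \<in> T" using e a Suc fU[of i] by (auto simp: T_def)
        then show ?thesis using fT Suc.prems by simp
      qed
    qed
  qed
  have fN: "\<not> E (f i) u" if "i < n" "u \<in> L" for i u
  proof (cases "i = 0")
    case True
    then show ?thesis using f(1) L(5) that z_def by simp
  next
    case False
    then show ?thesis using fT[OF that(1)] fU[of i] fL[of i] that by (auto simp: T_def)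
  qed
  define ys where "ys = map f (rev [0..<Suc n]) @ tl xs"
  have ys: "ys = f n # map f (rev [0..<n]) @ tl xs" by (simp add: ys_def)
  have ip: "ipath (z # tl xs)" using st xs unfolding gstate_def by metis
  have nr: "f i \<notin> set (tl xs) \<and> (\<forall>y\<in>set (tl xs). \<not> E y (f i))" if "1 \<le> i" "i \<le> n" for i
    using fU[OF that] tlH U(1) by blast
  have "ipath ys" unfolding ys_def
    by (rule ipath_append_walk[where f = f and n = n, OF ip f(1)]) (simp_all add: inj walk ind nr)
  moreover have "set ys \<subseteq> W"
  proof -
    have "f i \<in> W" if "i \<le> n" for i
      using that fU[of i] f(1) zH U(1) st by (cases "i = 0") (auto simp: gstate_def)
    moreover have "set (tl xs) \<subseteq> W" using st list.set_sel(2)[of xs] by (auto simp: gstate_def)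
    ultimately show ?thesis by (auto simp: ys_def)
  qed
  moreover have "L \<subseteq> W" using st U(1) L(1) by (auto simp: gstate_def)
  moreover have "set ys \<inter> L = {}"
    using fL tlH(2) L(1) U(1) by (fastforce simp: ys_def)
  moreover have "\<exists>v\<in>L. E (hd ys) v" using f(3) by (auto simp: T_def ys)
  moreover have "\<not> E x v" if "x \<in> set (tl ys)" "v \<in> L" for x v
    using that fN tlH(1) L(1) U(1) by (auto simp: ys)
  moreover have "\<not> col (K' - nb v) a'" if "v \<in> insert (hd ys) L" for v
    using that nh L(1) fU[of n] f(2) by (auto simp: ys)
  moreover have "length xs < length ys" using f(2) xs by (subst xs) (simp add: ys)
  ultimately have "length xs < length ys \<and> gstate W ys L K' a' l'"
    using L(3,4) unfolding gstate_def by (auto simp: ys)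
  then show ?thesis by blast
qed

lemma linked_mono: "linked H K k \<Longrightarrow> j \<le> k \<Longrightarrow> linked H K j"
  unfolding linked_def by (meson order_less_le_trans)

text \<open>The witness is the vertex after the last visit of the walk to \<open>z\<close>.\<close>

lemma rtrancl_leaves:
  assumes "(z, y) \<in> (rel U)\<^sup>*" "y \<noteq> z"
  shows "\<exists>w\<in>U - {z}. E z w \<and> (w, y) \<in> (rel (U - {z}))\<^sup>*"
  using assms
proof (induction rule: rtrancl_induct)
  case (step y y')
  show ?case
  proof (cases "y = z")
    case True
    then show ?thesis using step by (auto simp: rel_def)
  next
    case False
    then obtain w where w: "w \<in> U - {z}" "E z w" "(w, y) \<in> (rel (U - {z}))\<^sup>*" using step by blast
    have "(y, y') \<in> rel (U - {z})" using step False by (auto simp: rel_def)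
    then show ?thesis using w by (meson rtrancl.rtrancl_into_rtrancl)
  qed
qed simp

end

section \<open>Ramsey graphs and the growth of paths\<close>

text \<open>\<open>large\<close> and \<open>common\<close> share one number \<open>M\<close>, so
  that all losses can be measured in multiples of it; this is what makes the final bound linear in
  the Ramsey number.\<close>

locale ramsey_graph = rel_graph E for E :: "'a \<Rightarrow> 'a \<Rightarrow> bool" +
  fixes V :: "'a set" and s M :: nat
  assumes fin: "finite V" and M_pos: "1 \<le> M" and s_pos: "1 \<le> s"
    and large: "\<And>W. W \<subseteq> V \<Longrightarrow> M \<le> card W \<Longrightarrow> \<exists>S\<subseteq>W. card S = s \<and> stable S"
    and common: "\<And>S. S \<subseteq> V \<Longrightarrow> card S = s \<Longrightarrow> stable S \<Longrightarrow> col {u \<in> V. \<forall>v\<in>S. E v u} M"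
begin

lemma finite_sub: "W \<subseteq> V \<Longrightarrow> finite W"
  using fin finite_subset by blast

text \<open>Otherwise some \<open>s\<close> of these vertices form a stable set \<open>S\<close>. A
  vertex of \<open>K\<close> either misses a member of \<open>S\<close>, which gives
  \<open>s\<close> sets that are \<open>a\<close>-colourable, or is a common neighbour of
  \<open>S\<close>, so \<open>s * a + M\<close> colours suffice for \<open>K\<close>.\<close>

lemma card_nearly_complete:
  assumes "K \<subseteq> V" "\<not> col K (s * a + M)"
  shows "card {v \<in> V. col (K - nb v) a} < M"
proof (rule ccontr)
  assume "\<not> ?thesis"
  then obtain S where S: "S \<subseteq> {v \<in> V. col (K - nb v) a}" "card S = s" "stable S"
    using large[of "{v \<in> V. col (K - nb v) a}"] by auto
  have SV: "S \<subseteq> V" using S(1) by blast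
  have "col (\<Union>v\<in>S. K - nb v) (card S * a)"
    by (rule col_UN) (use S finite_sub[OF SV] in auto)
  then have "col ((\<Union>v\<in>S. K - nb v) \<union> {u \<in> V. \<forall>v\<in>S. E v u}) (s * a + M)"
    using col_Un common[OF SV S(2,3)] S(2) by blast
  moreover have "K \<subseteq> (\<Union>v\<in>S. K - nb v) \<union> {u \<in> V. \<forall>v\<in>S. E v u}"
    using assms(1) by (auto simp: nb_def)
  ultimately show False using assms(2) col_mono by blast
qed

text \<open>A linked pair \<open>H1\<close>, \<open>K1\<close> is taken among the non-neighbours of
  the head \<open>z\<close> in \<open>K\<close>, and the fewer than \<open>M\<close> vertices
  \<open>N\<close> nearly complete to \<open>K1\<close> are discarded. If \<open>z\<close> still has
  a neighbour in the component \<open>L\<close> of \<open>H - N\<close>, the path moves through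
  \<open>L\<close> towards \<open>L1\<close>. Otherwise \<open>L\<close> has no neighbour of
  \<open>z\<close> and contains the rest of \<open>K\<close>, so it becomes the next
  territory.\<close>

lemma gstate_step:
  assumes st: "gstate W xs H K a l" and W: "W \<subseteq> V"
    and a: "2 * (l' + M) + s * (a' + M) + M \<le> a" and l: "l' + M \<le> l" "1 \<le> l'"
  shows "\<exists>ys L K'. length xs < length ys \<and> gstate W ys L K' a' l'"
proof -
  define z where "z = hd xs"
  have HW: "H \<subseteq> W" and KH: "K \<subseteq> H" and link: "linked H K l"
    and cH: "conn H" and zH: "\<exists>w\<in>H. E z w"
    and nh: "\<And>v. v \<in> insert z H \<Longrightarrow> \<not> col (K - nb v) a"
    using st by (auto simp: gstate_def linked_def z_def)
  have KV: "K \<subseteq> V" using KH HW W by blast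
  have nc: "\<not> col (K - nb z) (s * (a' + M) + M + 2 * (l' + M))"
    by (rule not_col_mono[OF nh[of z]]) (use a in simp_all)
  obtain H1 K1 where 1: "K1 \<subseteq> H1" "H1 \<subseteq> K - nb z" "linked H1 K1 (l' + M)"
    and cK1: "\<not> col K1 (s * (a' + M) + M)"
    by (rule linked_subset_exists[OF finite_Diff[OF finite_sub[OF KV]] nc]) (rule that)
  have K1V: "K1 \<subseteq> V" using 1 KV by blast
  define N where "N = {v \<in> V. col (K1 - nb v) (a' + M)}"
  have cN: "card N < M" using card_nearly_complete[OF K1V cK1] by (simp add: N_def)
  have fN: "finite N" using fin by (simp add: N_def)
  have "\<not> col (K1 - N) (s * (a' + M))"
    by (rule not_col_Diff_card[OF cK1 fN]) (use cN in simp)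
  then obtain x where x: "x \<in> K1 - N" using not_col_nonempty by blast
  have cS: "card (N \<inter> Y) \<le> M" for Y using card_mono[OF fN, of "N \<inter> Y"] cN by simp
  have D: "Y - (N \<inter> Z) = Y - N" if "Y \<subseteq> Z" for Y Z using that by blast
  define L where "L = component (H - N) x"
  define L1 where "L1 = component (H1 - N) x"
  have xH: "x \<in> H - N" "x \<in> H1 - N" using x 1 KH by auto
  have LH: "L \<subseteq> H - N" "L1 \<subseteq> H1 - N"
    using component_subset xH by (simp_all add: L_def L1_def)
  have xL: "x \<in> L" "x \<in> L1" by (simp_all add: L_def L1_def component_refl)
  have L1L: "L1 \<subseteq> L"
    using rel_rtrancl_mono[of x _ "H1 - N" "H - N"] 1(2) KH by (auto simp: L_def L1_def component_def)
  have conL: "conn L" "conn L1" using conn_component xH by (simp_all add: L_def L1_def)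
  have linkL: "linked L (K - N) l'"
    using linked_component[OF linked_mono[OF link l(1)], of "N \<inter> H" x] fN cS[of H] x 1 l(2) D[OF KH] D[of H H]
    by (auto simp: L_def)
  have linkL1: "linked L1 (K1 - N) l'"
    using linked_component[OF 1(3), of "N \<inter> H1" x] fN cS[of H1] x l(2) D[OF 1(1)] D[of H1 H1]
    by (auto simp: L1_def)
  \<comment> \<open>Deleting \<open>N\<close> costs at most \<open>M\<close> colours, which is why
    \<open>N\<close> is defined with \<open>a' + M\<close>.\<close>
  have less: "\<not> col (Y - N - nb v) a'" if "\<not> col (Y - nb v) (a' + M)" for Y v
  proof -
    have "\<not> col (Y - nb v - N) a'" by (rule not_col_Diff_card[OF that fN]) (use cN in simp)
    then show ?thesis by (simp add: Diff_eq Int_ac)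
  qed
  have zL1: "\<not> E z u" if "u \<in> L1" for u using that LH(2) 1(2) by (auto simp: nb_def)
  show ?thesis
  proof (cases "\<exists>w\<in>L. E z w")
    case True
    then obtain w where w: "w \<in> L" "E (hd xs) w" by (auto simp: z_def)
    \<comment> \<open>The component \<open>L\<close> avoids \<open>N\<close>, so none of its
      vertices is nearly complete to \<open>K1\<close>.\<close>
    have "\<not> col (K1 - N - nb v) a'" if "v \<in> L" for v
    proof -
      have "v \<in> V - N" using that LH(1) HW W by blast
      then show ?thesis by (intro less) (simp add: N_def)
    qed
    then show ?thesis
      using gstate_advance[OF st _ conL(1) w L1L _ conL(2) linkL1, of a'] LH(1) xL(2) zL1 z_def by blast
  next
    case False
    obtain w where w: "w \<in> H" "E (hd xs) w" using zH by (auto simp: z_def)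
    have "a' + M \<le> s * (a' + M)" using s_pos by simp
    then have "a' + M \<le> a" using a by linarith
    then have "\<not> col (K - N - nb v) a'" if "v \<in> H" for v
      by (intro less not_col_mono[OF nh[of v]]) (use that in auto)
    then show ?thesis
      using gstate_advance[OF st order_refl cH w _ _ conL(1) linkL, of a'] LH(1) xL(1) False z_def by blast
  qed
qed

text \<open>As in \<open>gstate_step\<close>, but the first head \<open>z\<close> is itself a vertex
  of \<open>K0\<close> outside \<open>N\<close> and has to be removed from the territory. The extra
  units in the bound pay for this one vertex, both in linkedness and in colours.\<close>

lemma gstate_init:
  assumes W: "W \<subseteq> V" and c: "\<not> col W (2 * (l + M + 1) + s * (a + M + 1) + M)" and l: "1 \<le> l"
  shows "\<exists>xs H K. xs \<noteq> [] \<and> gstate W xs H K a l"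
proof -
  have nc: "\<not> col W (s * (a + M + 1) + M + 2 * (l + 1 + M))"
    using c by (simp add: add_ac)
  obtain H0 K0 where 0: "K0 \<subseteq> H0" "H0 \<subseteq> W" "linked H0 K0 (l + 1 + M)"
    and cK: "\<not> col K0 (s * (a + M + 1) + M)"
    by (rule linked_subset_exists[OF finite_sub[OF W] nc]) (rule that)
  have KV: "K0 \<subseteq> V" using 0 W by blast
  define N where "N = {v \<in> V. col (K0 - nb v) (a + M + 1)}"
  have cN: "card N < M" using card_nearly_complete[OF KV cK] by (simp add: N_def)
  have fN: "finite N" using fin by (simp add: N_def)
  have "\<not> col (K0 - N) (s * (a + M + 1))"
    by (rule not_col_Diff_card[OF cK fN]) (use cN in simp)
  then obtain z where z: "z \<in> K0 - N" using not_col_nonempty by blast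
  have D: "Y - (N \<inter> H0) = Y - N" if "Y \<subseteq> H0" for Y using that by blast
  define H1 where "H1 = component (H0 - N) z"
  have zH0: "z \<in> H0 - N" using z 0 by auto
  have H1: "H1 \<subseteq> H0 - N" "z \<in> H1" "conn H1"
    using component_subset[OF zH0] conn_component[OF zH0] by (simp_all add: H1_def component_refl)
  have "card (N \<inter> H0) \<le> M" using card_mono[OF fN, of "N \<inter> H0"] cN by simp
  then have link1: "linked H1 (K0 - N) (l + 1)"
    using linked_component[OF 0(3), of "N \<inter> H0" z] fN z D[OF 0(1)] D[of H0] by (auto simp: H1_def)
  have far: "\<not> col (K0 - N - {z} - nb v) a" if "v \<in> H1" for v
  proof -
    have "v \<in> V - N" using that H1(1) 0(2) W by auto
    then have "\<not> col (K0 - nb v) (a + (M + 1))" by (auto simp: N_def)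
    then have "\<not> col (K0 - nb v - insert z N) a"
      by (rule not_col_Diff_card) (use fN cN card_insert_le_m1[of "M + 1" N z] in auto)
    moreover have "K0 - N - {z} - nb v = K0 - nb v - insert z N" by blast
    ultimately show ?thesis by simp
  qed
  then obtain y where y: "y \<in> K0 - N - {z}" using not_col_nonempty H1(2) by blast
  then have yH1: "y \<in> H1 - {z}" using link1 by (auto simp: linked_def)
  define H where "H = component (H1 - {z}) y"
  have HH: "H \<subseteq> H1 - {z}" "conn H" using component_subset[OF yH1] conn_component[OF yH1] by (simp_all add: H_def)
  have "linked H (K0 - N - {z}) l"
    using linked_component[OF link1, of "{z}" y] H1(2) y l by (simp add: H_def)
  moreover have "\<exists>w\<in>H. E z w"
  proof -
    have "(z, y) \<in> (rel H1)\<^sup>*" using H1 yH1 by (auto simp: conn_def)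
    then obtain w where "E z w" "(w, y) \<in> (rel (H1 - {z}))\<^sup>*"
      using rtrancl_leaves yH1 by blast
    then show ?thesis using rel_rtrancl_sym by (auto simp: H_def component_def)
  qed
  ultimately have "gstate W [z] H (K0 - N - {z}) a l"
    using HH H1 0(2) far unfolding gstate_def by auto
  then show ?thesis by blast
qed

end

section \<open>Thresholds as constant multiples of \<open>M\<close>\<close>

text \<open>The recursion runs backwards from the parameters wanted at the end: one more step
  replaces \<open>a\<close> and \<open>l\<close> by the values that \<open>gstate_step\<close> must
  start from. In the base case the units of \<open>gstate_init\<close> are rounded up to multiples
  of \<open>M\<close>.\<close>

fun path_req :: "nat \<Rightarrow> nat \<Rightarrow> nat \<Rightarrow> nat \<Rightarrow> nat" where
  "path_req s 0 a l = 2 * (l + 2) + s * (a + 2) + 1"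
| "path_req s (Suc p) a l = path_req s p (2 * (l + 1) + s * (a + 1) + 1) (l + 1)"

text \<open>One more vertex costs what \<open>card_nearly_complete\<close> asks for a vertex with
  many-chromatic non-neighbourhood; the inner \<open>+ 1\<close> pays for deleting that
  vertex.\<close>

fun stab_req :: "nat \<Rightarrow> nat \<Rightarrow> nat" where
  "stab_req s 0 = 0"
| "stab_req s (Suc t) = s * (stab_req s t + 1) + 1"

context ramsey_graph begin

lemma gstate_exists:
  assumes W: "W \<subseteq> V" and "\<not> col W (path_req s p a l * M)" "1 \<le> l"
  shows "\<exists>xs H K. p < length xs \<and> gstate W xs H K (a * M) (l * M)"
  using assms(2,3)
proof (induction p arbitrary: a l)
  case 0
  have "2 * (l * M + M + 1) + s * (a * M + M + 1) + M \<le> path_req s 0 a l * M"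
  proof -
    have "a * M + M + 1 \<le> (a + 2) * M" using M_pos by (simp add: algebra_simps)
    then have "s * (a * M + M + 1) \<le> s * ((a + 2) * M)" by (rule mult_le_mono2)
    moreover have "2 * (l * M + M + 1) \<le> 2 * (l + 2) * M" using M_pos by (simp add: algebra_simps)
    moreover have "path_req s 0 a l * M = 2 * (l + 2) * M + s * ((a + 2) * M) + M"
      by (simp add: algebra_simps)
    ultimately show ?thesis by linarith
  qed
  then have "\<not> col W (2 * (l * M + M + 1) + s * (a * M + M + 1) + M)"
    using 0(1) col_mono by blast
  moreover have "1 \<le> l * M" using 0 M_pos by simp
  ultimately show ?case using gstate_init[OF W] by auto
next
  case (Suc p)
  obtain xs H K where len: "p < length xs" and
    st: "gstate W xs H K ((2 * (l + 1) + s * (a + 1) + 1) * M) ((l + 1) * M)"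
    using Suc.IH[of "2 * (l + 1) + s * (a + 1) + 1" "l + 1"] Suc.prems by auto
  have "\<exists>ys L K'. length xs < length ys \<and> gstate W ys L K' (a * M) (l * M)"
    by (rule gstate_step[OF st W]) (use Suc.prems M_pos in \<open>simp_all add: algebra_simps\<close>)
  then show ?case using len by (meson Suc_lessI less_trans_Suc not_less_eq order_less_trans)
qed

text \<open>For a vertex \<open>w\<close> of \<open>W\<close> outside \<open>N\<close> the
  non-neighbours in \<open>W\<close> still need many colours, and the induction finds the other
  vertices among them.\<close>

lemma stable_of_not_col:
  assumes "W \<subseteq> V" "\<not> col W (stab_req s t * M)"
  shows "\<exists>S\<subseteq>W. stable S \<and> card S = t"
  using assms
proof (induction t arbitrary: W)
  case 0
  then show ?case by (intro exI[of _ "{}"]) (auto simp: stable_def)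
next
  case (Suc t)
  define a where "a = stab_req s t * M + 1"
  have "s * a + M \<le> stab_req s (Suc t) * M"
  proof -
    have "s * a \<le> s * ((stab_req s t + 1) * M)" unfolding a_def using M_pos by (intro mult_left_mono) auto
    then show ?thesis by (simp add: algebra_simps)
  qed
  then have nc: "\<not> col W (s * a + M)" using Suc.prems(2) col_mono by blast
  define N where "N = {v \<in> V. col (W - nb v) a}"
  have "card N < M" using card_nearly_complete[OF Suc.prems(1) nc] by (simp add: N_def)
  moreover have "finite N" using fin by (simp add: N_def)
  ultimately have "\<not> col (W - N) (s * a)" by (intro not_col_Diff_card[OF nc]) auto
  then obtain w where w: "w \<in> W - N" using not_col_nonempty by blast
  have "\<not> col (W - nb w) (stab_req s t * M + 1)" using w Suc.prems(1) by (auto simp: N_def a_def)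
  then have "\<not> col (W - nb w - {w}) (stab_req s t * M)" by (rule not_col_Diff_card) auto
  then obtain S where S: "S \<subseteq> W - nb w - {w}" "stable S" "card S = t"
    using Suc.IH[of "W - nb w - {w}"] Suc.prems(1) by blast
  have "finite S" using S(1) Suc.prems(1) finite_sub by blast
  moreover have "w \<notin> S" using S(1) by blast
  ultimately have "card (insert w S) = Suc t" using S(3) by simp
  moreover have "stable (insert w S)"
    using S irrefl sym[of _ w] by (auto simp: stable_def nb_def)
  ultimately show ?case using w S(1) by (intro exI[of _ "insert w S"]) auto
qed

text \<open>\<open>large\<close> only yields stable sets of size \<open>s\<close>, while brooms need
  larger ones from a number of vertices still linear in \<open>M\<close>. Either \<open>W\<close>
  needs many colours and \<open>stable_of_not_col\<close> applies, or a colouring with few colours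
  has a class of size at least \<open>t\<close>.\<close>

lemma stable_of_card:
  assumes "W \<subseteq> V" "(stab_req s t * t + 1) * M \<le> card W"
  shows "\<exists>S\<subseteq>W. stable S \<and> card S = t"
proof (cases "col W (stab_req s t * M)")
  case False
  then show ?thesis using stable_of_not_col assms by blast
next
  case True
  then obtain c where c: "proper W (stab_req s t * M) c" by (auto simp: col_def)
  have "finite W" using assms finite_sub by blast
  have "card W \<le> (\<Sum>i<stab_req s t * M. card {v \<in> W. c v = i})"
  proof -
    have "W = (\<Union>i<stab_req s t * M. {v \<in> W. c v = i})" using c by (auto simp: proper_def)
    then show ?thesis using card_UN_le[of "{..<stab_req s t * M}" "\<lambda>i. {v \<in> W. c v = i}"] by simp
  qed
  have "\<exists>i. t \<le> card {v \<in> W. c v = i}"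
  proof (rule ccontr)
    assume "\<nexists>i. t \<le> card {v \<in> W. c v = i}"
    then have "card {v \<in> W. c v = i} \<le> t" for i by (meson linorder_not_le less_imp_le)
    then have "(\<Sum>i<stab_req s t * M. card {v \<in> W. c v = i}) \<le> (\<Sum>i<stab_req s t * M. t)"
      by (intro sum_mono)
    then have "card W \<le> stab_req s t * M * t" using \<open>card W \<le> _\<close> by simp
    then show False using assms(2) M_pos by (simp add: algebra_simps)
  qed
  then obtain i where i: "t \<le> card {v \<in> W. c v = i}" by blast
  obtain S where "S \<subseteq> {v \<in> W. c v = i}" "card S = t"
    using obtain_subset_with_card_n[OF i] by blast
  moreover have "stable {v \<in> W. c v = i}" using c unfolding stable_def proper_def by fastforce
  ultimately show ?thesis using stable_subset by blast
qed

text \<open>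
  If every \<open>l\<close>-subset of \<open>S\<close> dominates most of \<open>Q\<close>, then most vertices of \<open>Q\<close> have at least \<open>s\<close>
  neighbours in \<open>S\<close>, so \<open>Q\<close> is covered by few common neighbourhoods.
\<close>

lemma leaves_missing_much:
  assumes S: "S \<subseteq> V" "stable S" "card S = l + s - 1"
    and Q: "Q \<subseteq> V" "\<not> col Q (2 ^ (l + s) * (q + M))"
  shows "\<exists>I\<subseteq>S. card I = l \<and> \<not> col {u \<in> Q. \<forall>v\<in>I. \<not> E v u} q"
proof (rule ccontr)
  assume no: "\<not> ?thesis"
  have finS: "finite S" using S finite_sub by blast
  have "col {u \<in> Q. S \<inter> nb u = X} (q + M)" if "X \<in> Pow S" for X
  proof (cases "s \<le> card X")
    case True
    then obtain J where J: "J \<subseteq> X" "card J = s" by (meson obtain_subset_with_card_n)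
    then have "col {u \<in> V. \<forall>v\<in>J. E v u} M"
      using common[of J] S that stable_subset[of S J] by auto
    then show ?thesis
      by (rule col_mono) (use J Q(1) sym in \<open>auto simp: nb_def\<close>)
  next
    case False
    have "card (S - X) = card S - card X"
      using that finS by (intro card_Diff_subset) (auto intro: finite_subset)
    \<comment> \<open>This is where \<open>l + s - 1\<close> comes from: fewer than \<open>s\<close>
      vertices of \<open>S\<close> lie in \<open>X\<close>, so \<open>l\<close> remain.\<close>
    then have "l \<le> card (S - X)" using False S(3) by linarith
    then obtain I where I: "I \<subseteq> S - X" "card I = l" by (meson obtain_subset_with_card_n)
    then have "col {u \<in> Q. \<forall>v\<in>I. \<not> E v u} q" using no by blast
    then show ?thesis
      by (rule col_mono) (use I sym in \<open>auto simp: nb_def\<close>)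
  qed
  then have "col (\<Union>X\<in>Pow S. {u \<in> Q. S \<inter> nb u = X}) (card (Pow S) * (q + M))"
    using finS by (intro col_UN) auto
  moreover have "Q \<subseteq> (\<Union>X\<in>Pow S. {u \<in> Q. S \<inter> nb u = X})"
  proof
    fix u assume "u \<in> Q"
    then show "u \<in> (\<Union>X\<in>Pow S. {u \<in> Q. S \<inter> nb u = X})"
      by (intro UN_I[of "S \<inter> nb u"]) simp_all
  qed
  moreover have "card (Pow S) * (q + M) \<le> 2 ^ (l + s) * (q + M)"
    using finS S(3) by (intro mult_right_mono) (auto simp: card_Pow)
  ultimately show False using Q(2) col_mono by blast
qed

end

section \<open>Brooms with a large anticomplete remainder\<close>

context ramsey_graph begin

text \<open>The handle runs from the centre back along the walk and then along the old path, which
  alone is long enough. The leaves are private neighbours of the centre, so they see no other vertex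
  of the handle, and \<open>Q\<close> is what is left of \<open>K\<close>.\<close>

lemma broom_of_gstate:
  assumes st: "gstate W xs H K a d" and W: "W \<subseteq> V" and k: "1 \<le> k" "k \<le> length xs"
    and C: "(stab_req s (l + s - 1) * (l + s - 1) + 1) * M \<le> C" "3 * C \<le> d"
    and a: "2 ^ (l + s) * (q + (k + l) + M) + C \<le> a"
  shows "\<exists>ys I Q. length ys = k \<and> ipath ys \<and> set ys \<subseteq> W \<and> I \<subseteq> W \<and> stable I \<and> card I = l \<and>
    I \<inter> set ys = {} \<and> (\<forall>w\<in>I. \<forall>y\<in>set ys. E w y \<longleftrightarrow> y = hd ys) \<and>
    Q \<subseteq> W \<and> Q \<inter> (set ys \<union> I) = {} \<and> (\<forall>u\<in>Q. \<forall>v\<in>set ys \<union> I. \<not> E u v) \<and> \<not> col Q q"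
proof -
  define z where "z = hd xs"
  have HW: "H \<subseteq> W" and KH: "K \<subseteq> H" and link: "linked H K d"
    and cH: "conn H" and zw: "\<exists>w\<in>H. E z w"
    and nh: "\<And>v. v \<in> insert z H \<Longrightarrow> \<not> col (K - nb v) a"
    using st by (auto simp: gstate_def linked_def z_def)
  have xs: "xs = z # tl xs" using st by (simp add: gstate_def z_def)
  have zH: "z \<in> W" "z \<notin> H" using st hd_in_set[of xs] unfolding gstate_def z_def by blast+
  have tlW: "set (tl xs) \<subseteq> W" using st list.set_sel(2)[of xs] by (auto simp: gstate_def)
  have tlH: "\<not> E y u" "y \<noteq> u" if "y \<in> set (tl xs)" "u \<in> H" for y u
    using that st list.set_sel(2)[of xs y] by (auto simp: gstate_def)
  have ip: "ipath (z # tl xs)" using st xs unfolding gstate_def by metis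
  have finH: "finite H" using HW W finite_sub by blast
  have "1 * M \<le> (stab_req s (l + s - 1) * (l + s - 1) + 1) * M" by (rule mult_le_mono1) simp
  then have C1: "1 \<le> C" using C(1) M_pos by linarith
  obtain w where w: "w \<in> H" "E z w" using zw by blast
  obtain x where x: "x \<in> K" using not_col_nonempty[OF nh[of z]] by blast
  have reach: "(w, x) \<in> (rel H)\<^sup>*" using cH w x KH by (auto simp: conn_def)
  have zK: "z \<notin> K" using zH KH by blast
  obtain n f where f: "f 0 = z" "n \<ge> 1" "f n \<in> K" and fH: "\<And>i. 1 \<le> i \<Longrightarrow> i \<le> n \<Longrightarrow> f i \<in> H"
    and fK: "\<And>i. i < n \<Longrightarrow> f i \<notin> K"
    and walk: "\<And>i. i < n \<Longrightarrow> E (f i) (f (Suc i))"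
    and inj: "\<And>i j. i < j \<Longrightarrow> j \<le> n \<Longrightarrow> f i \<noteq> f j"
    and ind: "\<And>i j. i < j \<Longrightarrow> j \<le> n \<Longrightarrow> E (f i) (f j) \<Longrightarrow> j = Suc i"
    and near: "\<And>i w. i \<le> n \<Longrightarrow> w \<in> K \<Longrightarrow> w \<in> H \<Longrightarrow> E (f i) w \<Longrightarrow> n \<le> i + 1"
    and near2: "\<And>i w. i \<le> n \<Longrightarrow> w \<in> H \<Longrightarrow> E (f i) w \<Longrightarrow> E w (f n) \<Longrightarrow> n \<le> i + 2"
    by (rule shortest_walk[OF zK w reach x]) (rule that)
  \<comment> \<open>The private neighbours of \<open>f j\<close>: those whose first neighbour on the
    walk is \<open>f j\<close>. By \<open>first\<close>, every vertex of \<open>H\<close> with a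
    neighbour on the walk lies in one of these sets.\<close>
  define P where "P j = {w \<in> H. E (f j) w \<and> (\<forall>i<j. \<not> E (f i) w)}" for j
  have finP: "finite (P j)" for j using finH by (simp add: P_def)
  have first: "\<exists>i\<le>j. w \<in> P i" if wH: "w \<in> H" and e: "E (f j) w" for w j
  proof -
    obtain i where "E (f i) w" "\<forall>i'<i. \<not> E (f i') w"
      using exists_least_iff[of "\<lambda>i. E (f i) w"] e by blast
    moreover from this have "i \<le> j" using e not_le by blast
    ultimately show ?thesis using wH unfolding P_def by blast
  qed
  \<comment> \<open>If all these sets were small, the neighbours of \<open>f n\<close> in
    \<open>H\<close> would lie in the last three of them by \<open>near2\<close>. Deleting these
    fewer than \<open>d\<close> vertices would cut \<open>f n\<close> off from another vertex of
    \<open>K\<close>, against linkedness.\<close>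
  have "\<exists>j. j \<le> n \<and> C \<le> card (P j)"
  proof (rule ccontr)
    assume no: "\<not> ?thesis"
    define S where "S = H \<inter> nb (f n)"
    \<comment> \<open>For \<open>n = 1\<close> the truncated \<open>n - 2\<close> equals
      \<open>n - 1\<close>, which merely repeats a set.\<close>
    have "S \<subseteq> P n \<union> P (n - 1) \<union> P (n - 2)"
    proof
      fix u assume u: "u \<in> S"
      then obtain i where i: "i \<le> n" "u \<in> P i" using first[of u n] by (auto simp: S_def nb_def)
      then have "n \<le> i + 2" using near2[of i u] u sym[of "f n" u] by (auto simp: P_def S_def nb_def)
      then have "i = n \<or> i = n - 1 \<or> i = n - 2" using i(1) by linarith
      then show "u \<in> P n \<union> P (n - 1) \<union> P (n - 2)" using i(2) by blast
    qed
    then have "card S \<le> card (P n \<union> P (n - 1) \<union> P (n - 2))" using finP by (intro card_mono) auto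
    also have "\<dots> \<le> card (P n) + card (P (n - 1)) + card (P (n - 2))"
      by (meson add_right_mono card_Un_le order_trans)
    also have "\<dots> < 3 * C"
    proof -
      have "card (P i) < C" if "i \<le> n" for i using no that by (meson not_le)
      from this[of n] this[of "n - 1"] this[of "n - 2"] show ?thesis by linarith
    qed
    finally have cS: "card S < d" using C(2) by linarith
    have "\<not> col (K - nb (f n)) (0 + 1)"
      using not_col_mono[OF nh[of "f n"], of 1] a C1 fH[of n] f(2) by simp
    then have "\<not> col (K - nb (f n) - {f n}) 0" by (rule not_col_Diff_card) auto
    then obtain y where y: "y \<in> K - nb (f n)" "y \<noteq> f n" using not_col_nonempty by blast
    have "f n \<in> K - S" "y \<in> K - S" using f(3) y irrefl by (auto simp: S_def nb_def)
    then have "(f n, y) \<in> (rel (H - S))\<^sup>*"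
      using link cS unfolding linked_def S_def by blast
    then obtain u where "(f n, u) \<in> rel (H - S)" using y(2) by (metis converse_rtranclE)
    then show False by (auto simp: rel_def S_def nb_def)
  qed
  then obtain j where j: "j \<le> n" "C \<le> card (P j)" and small: "\<And>i. i < j \<Longrightarrow> card (P i) < C"
    using exists_least_iff[of "\<lambda>j. j \<le> n \<and> C \<le> card (P j)"] by (metis le_trans less_imp_le not_le)
  \<comment> \<open>These vertices of \<open>K\<close> see the walk before the centre and must be
    removed. By \<open>near\<close> they exist only for \<open>j = n\<close> and then lie in
    \<open>P (n - 1)\<close>, which is small by the minimality of \<open>j\<close>.\<close>
  define Z where "Z = {w \<in> K. \<exists>i<j. E (f i) w}"
  have Z: "w \<in> P (n - 1) \<and> n - 1 < j" if wZ: "w \<in> Z" for w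
  proof -
    obtain i' where i': "i' < j" "E (f i') w" "w \<in> H" using wZ KH by (auto simp: Z_def)
    then obtain i where "i \<le> i'" "w \<in> P i" using first by blast
    then have i: "i < j" "w \<in> P i" using i'(1) by auto
    then have "n \<le> i + 1" using near[of i w] wZ j(1) by (auto simp: Z_def P_def)
    then have "i = n - 1" using i(1) j(1) by linarith
    then show ?thesis using i by simp
  qed
  have "col Z C"
  proof (cases "Z = {}")
    case True
    then show ?thesis by (simp add: col_def proper_def)
  next
    case False
    then have "Z \<subseteq> P (n - 1)" "card (P (n - 1)) \<le> C" using Z small by (auto intro: less_imp_le)
    then show ?thesis using col_mono[OF col_card[OF finP]] by blast
  qed
  have fjH: "f j \<in> insert z H" using fH[of j] f(1) j(1) by (cases "j = 0") auto
  define Q0 where "Q0 = K - nb (f j) - Z"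
  have cQ0: "\<not> col Q0 (2 ^ (l + s) * (q + (k + l) + M))" unfolding Q0_def
    by (rule not_col_Diff[OF not_col_mono[OF nh[OF fjH] a] \<open>col Z C\<close>])
  have Q0V: "Q0 \<subseteq> V" using KH HW W by (auto simp: Q0_def)
  have PV: "P j \<subseteq> V" using HW W by (auto simp: P_def)
  obtain S where S: "S \<subseteq> P j" "stable S" "card S = l + s - 1"
    using stable_of_card[OF PV le_trans[OF C(1) j(2)]] by blast
  obtain I where I: "I \<subseteq> S" "card I = l"
    and cI: "\<not> col {u \<in> Q0. \<forall>v\<in>I. \<not> E v u} (q + (k + l))"
    using leaves_missing_much[OF subset_trans[OF S(1) PV] S(2,3) Q0V cQ0] by blast
  have IP: "I \<subseteq> P j" using I S by blast
  define zs where "zs = map f (rev [0..<Suc j]) @ tl xs"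
  have zs: "zs = f j # map f (rev [0..<j]) @ tl xs" by (simp add: zs_def)
  have set_zs: "set zs = f ` {..j} \<union> set (tl xs)" unfolding zs_def
    by (simp only: set_append set_map set_rev set_upt) (simp add: atLeast0LessThan lessThan_Suc_atMost)
  have nr: "f i \<notin> set (tl xs) \<and> (\<forall>y\<in>set (tl xs). \<not> E y (f i))" if "1 \<le> i" "i \<le> n" for i
    using fH[OF that] tlH by blast
  have "ipath zs" unfolding zs_def
    by (rule ipath_append_walk[where f = f and n = n, OF ip f(1)]) (simp_all add: inj walk ind nr j)
  \<comment> \<open>Only the \<open>k\<close> vertices nearest to the centre are kept.\<close>
  define ys where "ys = take k zs"
  have ys: "ipath ys" "set ys \<subseteq> set zs" "hd ys = f j"
    using ipath_take[OF \<open>ipath zs\<close>] set_take_subset[of k zs] k(1) unfolding ys_def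
    by (simp_all add: zs hd_take)
  have "length xs = Suc (length (tl xs))" by (subst xs) simp
  then have len: "length ys = k" using k(2) by (simp add: ys_def zs)
  have zsW: "set zs \<subseteq> W"
  proof -
    have "f i \<in> W" if "i \<le> n" for i
      using that fH[of i] f(1) zH HW by (cases "i = 0") auto
    then show ?thesis using tlW j(1) by (auto simp: set_zs)
  qed
  have leaf: "w \<noteq> y \<and> (E w y \<longleftrightarrow> y = f j)" if wP: "w \<in> P j" and yzs: "y \<in> set zs" for w y
  proof -
    have wH: "w \<in> H" using wP by (simp add: P_def)
    consider i where "i \<le> j" "y = f i" | "y \<in> set (tl xs)" using yzs unfolding set_zs by blast
    then show ?thesis
    proof cases
      case 1
      \<comment> \<open>For \<open>0 < i < j\<close> the vertex \<open>f i\<close> is adjacent to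
        \<open>f (i - 1)\<close>, so it is not private to \<open>f j\<close>; and \<open>f 0\<close>
        lies outside \<open>H\<close>.\<close>
      have "w \<noteq> f i"
      proof
        assume eq: "w = f i"
        then have "i \<noteq> 0" using zH wH f(1) by metis
        then obtain i' where i': "i = Suc i'" using not0_implies_Suc by blast
        show False
        proof (cases "i = j")
          case True
          then show ?thesis using wP eq irrefl by (auto simp: P_def)
        next
          case False
          then show ?thesis using walk[of i'] wP eq i' 1 j(1) by (auto simp: P_def)
        qed
      qed
      moreover have "E w (f i) \<longleftrightarrow> f i = f j"
      proof (cases "i = j")
        case True
        then show ?thesis using wP sym[of "f j" w] by (auto simp: P_def)
      next
        case False
        then show ?thesis using wP sym[of w "f i"] 1 inj[of i j] j(1) by (auto simp: P_def)
      qed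
      ultimately show ?thesis using 1 by simp
    next
      case 2
      have "y \<noteq> f j"
      proof (cases "j = 0")
        case True
        then show ?thesis using ip 2 f(1) by auto
      next
        case False
        then show ?thesis using nr[of j] 2 j(1) by auto
      qed
      then show ?thesis using tlH[OF 2 wH] sym[of w y] by blast
    qed
  qed
  define Q where "Q = {u \<in> Q0. \<forall>v\<in>I. \<not> E v u} - (set ys \<union> I)"
  have "finite I" using IP finP finite_subset by blast
  moreover have "card (set ys \<union> I) \<le> k + l"
    using card_Un_le[of "set ys" I] card_length[of ys] len I(2) by linarith
  ultimately have "\<not> col Q q" unfolding Q_def by (intro not_col_Diff_card[OF cI]) auto
  moreover have "\<not> E u v" if u: "u \<in> Q" and v: "v \<in> set ys \<union> I" for u v
  proof -
    have uH: "u \<in> H" using u KH by (auto simp: Q_def Q0_def)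
    have "\<not> E v u"
    proof (cases "v \<in> I")
      case True
      then show ?thesis using u by (auto simp: Q_def)
    next
      case False
      then have "v \<in> set zs" using v ys(2) by blast
      then consider i where "i \<le> j" "v = f i" | "v \<in> set (tl xs)" unfolding set_zs by blast
      then show ?thesis
      proof cases
        case 1
        then show ?thesis using u by (cases "i = j") (auto simp: Q_def Q0_def Z_def nb_def)
      next
        case 2
        then show ?thesis using tlH uH by blast
      qed
    qed
    then show ?thesis using sym by blast
  qed
  moreover have "Q \<subseteq> W" using KH HW by (auto simp: Q_def Q0_def)
  moreover have "Q \<inter> (set ys \<union> I) = {}" by (auto simp: Q_def)
  moreover have "stable I" using S(2) I(1) stable_subset by blast
  moreover have "I \<subseteq> W" using IP HW by (auto simp: P_def)
  moreover have "I \<inter> set ys = {}" using leaf IP ys(2) by blast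
  moreover have "\<forall>w\<in>I. \<forall>y\<in>set ys. E w y \<longleftrightarrow> y = hd ys"
    unfolding ys(3) using leaf IP ys(2) by (meson subsetD)
  moreover have "set ys \<subseteq> W" using ys(2) zsW by blast
  ultimately show ?thesis using ys(1) len I(2)
    by (intro exI[of _ ys] exI[of _ I] exI[of _ Q] conjI) simp_all
qed

end

text \<open>Among \<open>c * M\<close> vertices there is a stable set of \<open>l + s - 1\<close>
  candidates for leaves, and \<open>3 * c\<close> accounts for three sets of private neighbours. The
  power of two counts traces in \<open>leaves_missing_much\<close>, and \<open>k + l\<close> pays
  for removing the broom from the remainder.\<close>

definition broom_req :: "nat \<Rightarrow> nat \<Rightarrow> nat \<Rightarrow> nat \<Rightarrow> nat" where
  "broom_req s k l q = (let c = stab_req s (l + s - 1) * (l + s - 1) + 1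
     in path_req s k (2 ^ (l + s) * (q + (k + l) + 1) + c) (3 * c))"

lemma (in ramsey_graph) broom_exists:
  assumes "W \<subseteq> V" "1 \<le> k" "\<not> col W (broom_req s k l q * M)"
  shows "\<exists>ys I Q. length ys = k \<and> ipath ys \<and> set ys \<subseteq> W \<and> I \<subseteq> W \<and> stable I \<and> card I = l \<and>
    I \<inter> set ys = {} \<and> (\<forall>w\<in>I. \<forall>y\<in>set ys. E w y \<longleftrightarrow> y = hd ys) \<and>
    Q \<subseteq> W \<and> Q \<inter> (set ys \<union> I) = {} \<and> (\<forall>u\<in>Q. \<forall>v\<in>set ys \<union> I. \<not> E u v) \<and> \<not> col Q (q * M)"
proof -
  define c where "c = stab_req s (l + s - 1) * (l + s - 1) + 1"
  define a where "a = 2 ^ (l + s) * (q + (k + l) + 1) + c"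
  have "\<not> col W (path_req s k a (3 * c) * M)"
    using assms(3) by (simp add: broom_req_def a_def c_def Let_def)
  moreover have "1 \<le> 3 * c" by (simp add: c_def)
  ultimately obtain xs H K where len: "k < length xs" and st: "gstate W xs H K (a * M) (3 * c * M)"
    using gstate_exists[OF assms(1)] by blast
  have "k + l \<le> (k + l) * M" using M_pos by simp
  then have "q * M + (k + l) + M \<le> (q + (k + l) + 1) * M" unfolding add_mult_distrib by simp
  then have "2 ^ (l + s) * (q * M + (k + l) + M) \<le> 2 ^ (l + s) * ((q + (k + l) + 1) * M)"
    by (rule mult_le_mono2)
  also have "\<dots> + c * M = a * M" by (simp only: a_def add_mult_distrib mult.assoc)
  finally have le: "2 ^ (l + s) * (q * M + (k + l) + M) + c * M \<le> a * M" by simp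
  show ?thesis
    by (rule broom_of_gstate[OF st assms(1,2) _ _ _ le]) (use len in \<open>simp_all add: c_def algebra_simps\<close>)
qed

section \<open>Forests of brooms and the Ramsey number\<close>

text \<open>\<open>F\<close> may contain pairs outside \<open>X\<close>, so the edge set of the
  whole forest serves for every union of its components.\<close>

definition embeds :: "('b \<Rightarrow> 'a) \<Rightarrow> 'b set \<Rightarrow> 'b set set \<Rightarrow> ('a \<Rightarrow> 'a \<Rightarrow> bool) \<Rightarrow> 'a set \<Rightarrow> bool" where
  "embeds f X F E W \<longleftrightarrow> inj_on f X \<and> f ` X \<subseteq> W \<and>
     (\<forall>u\<in>X. \<forall>v\<in>X. {u, v} \<in> F \<longleftrightarrow> E (f u) (f v))"

text \<open>The path that replaces the subdivided edge, from the centre to the old leaf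
  \<open>l + 1\<close>; for \<open>k = 2\<close> it is that edge itself.\<close>

definition handle :: "nat \<Rightarrow> nat \<Rightarrow> nat list" where
  "handle k l = 0 # [l + 2..<l + k] @ [l + 1]"

lemma length_handle: "2 \<le> k \<Longrightarrow> length (handle k l) = k"
  by (simp add: handle_def)

lemma distinct_handle: "distinct (handle k l)"
  by (simp add: handle_def)

lemma handle_leaf: "v \<in> set (handle k l) \<Longrightarrow> v \<notin> {1..l}"
  by (auto simp: handle_def)

lemma verts_broom: "verts (broom k l) = {1..l} \<union> set (handle k l)"
  by (auto simp: broom_def subdivide_edge_def star_def handle_def)

lemma edges_broom:
  "{u, v} \<in> edges (broom k l) \<longleftrightarrow> u = 0 \<and> v \<in> {1..l} \<or> v = 0 \<and> u \<in> {1..l} \<or>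
     (\<exists>i. Suc i < length (handle k l) \<and> {u, v} = {handle k l ! i, handle k l ! Suc i})"
proof -
  have "{u, v} \<in> {{0, i} |i. i \<in> {1..l + 1}} - {{0, l + 1}} \<longleftrightarrow>
      u = 0 \<and> v \<in> {1..l} \<or> v = 0 \<and> u \<in> {1..l}"
    by (auto simp: doubleton_eq_iff)
  then show ?thesis
    by (auto simp: broom_def subdivide_edge_def star_def path_edges_def handle_def)
qed

context rel_graph begin

text \<open>The leaves other than the end of the handle go to \<open>I\<close> in any order, and the
  handle goes to \<open>ys\<close> position by position, with the centre at the head.\<close>

lemma broom_embeds:
  assumes k: "2 \<le> k" and ys: "length ys = k" "ipath ys" and I: "finite I" "stable I" "card I = l"
    "I \<inter> set ys = {}" "\<And>w y. w \<in> I \<Longrightarrow> y \<in> set ys \<Longrightarrow> E w y \<longleftrightarrow> y = hd ys"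
  shows "\<exists>f. embeds f (verts (broom k l)) (edges (broom k l)) E (set ys \<union> I)"
proof -
  obtain g where g: "bij_betw g {1..l} I"
    using I(1,3) by (metis card_atLeastAtMost diff_Suc_1 finite_atLeastAtMost finite_same_card_bij)
  define hs where "hs = handle k l"
  have hs: "length hs = k" "distinct hs" using k by (simp_all add: hs_def length_handle distinct_handle)
  \<comment> \<open>The vertices of the handle are distinct, so each has exactly one
    position.\<close>
  define f where "f v = (if v \<in> {1..l} then g v else ys ! (THE i. i < k \<and> hs ! i = v))" for v
  have fh: "f (hs ! i) = ys ! i" if "i < k" for i
  proof -
    have "(THE j. j < k \<and> hs ! j = hs ! i) = i"
      using that hs by (intro the_equality) (auto simp: nth_eq_iff_index_eq)
    moreover have "hs ! i \<notin> {1..l}" using that hs handle_leaf[of "hs ! i" k l] by (simp add: hs_def)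
    ultimately show ?thesis by (simp only: f_def if_False)
  qed
  have fl: "f v \<in> I" if "v \<in> {1..l}" for v using that g by (auto simp: f_def bij_betw_def)
  have V: "verts (broom k l) = {1..l} \<union> set hs" by (simp add: verts_broom hs_def)
  have dys: "distinct ys" using ys ipath_distinct by blast
  have ys0: "ys ! i = hd ys \<longleftrightarrow> i = 0" if "i < k" for i
    using that ys(1) dys nth_eq_iff_index_eq[of ys i 0] by (cases ys) auto
  have hs0: "hs ! i = 0 \<longleftrightarrow> i = 0" if "i < k" for i
    using that hs k nth_eq_iff_index_eq[of hs i 0] by (auto simp: hs_def handle_def)
  have notleaf: "hs ! i \<notin> {1..l}" if "i < k" for i
    using that hs handle_leaf[of "hs ! i" k l] by (simp add: hs_def)
  have ed: "{u, v} \<in> edges (broom k l) \<longleftrightarrow> u = 0 \<and> v \<in> {1..l} \<or> v = 0 \<and> u \<in> {1..l} \<or>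
     (\<exists>i. Suc i < k \<and> {u, v} = {hs ! i, hs ! Suc i})" for u v
    using edges_broom[of u v k l] hs(1) by (simp add: hs_def)
  have LL: "{u, v} \<in> edges (broom k l) \<longleftrightarrow> E (f u) (f v)" if "u \<in> {1..l}" "v \<in> {1..l}" for u v
  proof -
    have "\<not> E (f u) (f v)" using fl that I(2) by (auto simp: stable_def)
    moreover have "{u, v} \<notin> edges (broom k l)"
      using that notleaf unfolding ed by (auto simp: doubleton_eq_iff)
    ultimately show ?thesis by simp
  qed
  have LH: "{u, hs ! j} \<in> edges (broom k l) \<longleftrightarrow> E (f u) (f (hs ! j))" if "u \<in> {1..l}" "j < k" for u j
  proof -
    have "E (f u) (f (hs ! j)) \<longleftrightarrow> j = 0"
      using I(5)[OF fl[OF that(1)], of "ys ! j"] ys0 fh that ys(1) by simp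
    moreover have "{u, hs ! j} \<in> edges (broom k l) \<longleftrightarrow> j = 0"
      using that notleaf hs0 unfolding ed by (auto simp: doubleton_eq_iff)
    ultimately show ?thesis by simp
  qed
  have HH: "{hs ! i, hs ! j} \<in> edges (broom k l) \<longleftrightarrow> E (f (hs ! i)) (f (hs ! j))" if "i < k" "j < k" for i j
  proof -
    have "{hs ! i, hs ! j} \<in> edges (broom k l) \<longleftrightarrow> (\<exists>m. Suc m < k \<and> {hs ! i, hs ! j} = {hs ! m, hs ! Suc m})"
      using notleaf that unfolding ed by blast
    also have "\<dots> \<longleftrightarrow> i = Suc j \<or> j = Suc i"
      using that hs by (auto simp: doubleton_eq_iff nth_eq_iff_index_eq)
    also have "\<dots> \<longleftrightarrow> E (f (hs ! i)) (f (hs ! j))"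
      using ipath_nth[OF ys(2), of i j] that ys(1) fh by simp
    finally show ?thesis .
  qed
  have "{u, v} \<in> edges (broom k l) \<longleftrightarrow> E (f u) (f v)"
    if u: "u \<in> verts (broom k l)" and v: "v \<in> verts (broom k l)" for u v
  proof (cases "u \<in> {1..l}"; cases "v \<in> {1..l}")
    assume "u \<in> {1..l}" "v \<in> {1..l}"
    then show ?thesis using LL by blast
  next
    assume "u \<in> {1..l}" "v \<notin> {1..l}"
    then obtain j where "j < k" "v = hs ! j" using v hs(1) unfolding V by (metis UnE in_set_conv_nth)
    then show ?thesis using LH \<open>u \<in> {1..l}\<close> by blast
  next
    assume "u \<notin> {1..l}" "v \<in> {1..l}"
    then obtain j where "j < k" "u = hs ! j" using u hs(1) unfolding V by (metis UnE in_set_conv_nth)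
    then show ?thesis using LH[OF \<open>v \<in> {1..l}\<close>, of j] sym by (metis insert_commute)
  next
    assume "u \<notin> {1..l}" "v \<notin> {1..l}"
    then obtain i j where "i < k" "u = hs ! i" "j < k" "v = hs ! j"
      using u v hs(1) unfolding V by (metis UnE in_set_conv_nth)
    then show ?thesis using HH by blast
  qed
  moreover have "f ` set hs \<subseteq> set ys"
  proof (rule image_subsetI)
    fix v assume "v \<in> set hs"
    then obtain i where "i < k" "v = hs ! i" using hs(1) by (metis in_set_conv_nth)
    then show "f v \<in> set ys" using fh ys(1) by simp
  qed
  moreover have "f ` {1..l} \<subseteq> I" using fl by blast
  moreover have "inj_on f (verts (broom k l))"
  proof -
    have "f v = g v" if "v \<in> {1..l}" for v using that by (simp only: f_def if_True)
    then have "inj_on f {1..l}" using g inj_on_cong[of "{1..l}" f g] by (simp only: bij_betw_def)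
    moreover have "inj_on f (set hs)"
    proof (rule inj_onI)
      fix u v assume "u \<in> set hs" "v \<in> set hs" and eq: "f u = f v"
      then obtain i j where "i < k" "u = hs ! i" "j < k" "v = hs ! j" using hs(1) by (metis in_set_conv_nth)
      then show "u = v" using eq fh ys(1) dys by (simp add: nth_eq_iff_index_eq)
    qed
    moreover have "f ` ({1..l} - set hs) \<inter> f ` (set hs - {1..l}) = {}"
      using I(4) \<open>f ` set hs \<subseteq> set ys\<close> \<open>f ` {1..l} \<subseteq> I\<close> by blast
    ultimately show ?thesis unfolding V by (simp only: inj_on_Un)
  qed
  moreover have "f ` verts (broom k l) \<subseteq> set ys \<union> I"
    using \<open>f ` set hs \<subseteq> set ys\<close> \<open>f ` {1..l} \<subseteq> I\<close> unfolding V by blast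
  ultimately have "embeds f (verts (broom k l)) (edges (broom k l)) E (set ys \<union> I)"
    by (simp add: embeds_def)
  then show ?thesis by blast
qed

end

section \<open>Components of the forest and gluing of embeddings\<close>

lemma component_props:
  assumes T: "simple_graph T" and h: "h \<in> components T"
  shows "verts h \<subseteq> verts T"
    and "\<And>u v. u \<in> verts h \<Longrightarrow> v \<in> verts h \<Longrightarrow> {u, v} \<in> edges h \<longleftrightarrow> {u, v} \<in> edges T"
    and "\<And>x y. x \<in> verts h \<Longrightarrow> {x, y} \<in> edges T \<Longrightarrow> y \<in> verts h"
proof -
  obtain u where h': "h = component_of T u" using h by (auto simp: components_def)
  show "verts h \<subseteq> verts T" by (auto simp: h' component_of_def induced_subgraph_def)
  show "{u, v} \<in> edges h \<longleftrightarrow> {u, v} \<in> edges T" if "u \<in> verts h" "v \<in> verts h" for u v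
    using that by (auto simp: h' component_of_def induced_subgraph_def)
  fix x y assume x: "x \<in> verts h" and e: "{x, y} \<in> edges T"
  have "y \<in> verts T" using e T by (auto simp: simple_graph_def nsets_def)
  moreover have "(u, y) \<in> {(x, y). {x, y} \<in> edges T}\<^sup>*"
    using x e by (auto simp: h' component_of_def induced_subgraph_def intro: rtrancl_into_rtrancl)
  ultimately show "y \<in> verts h" by (auto simp: h' component_of_def induced_subgraph_def)
qed

lemma component_unique:
  assumes "h \<in> components T" "h' \<in> components T" "x \<in> verts h" "x \<in> verts h'"
  shows "h = h'"
proof -
  define r where "r = {(x, y). {x, y} \<in> edges T}"
  have "sym_on UNIV r" by (auto simp: r_def insert_commute intro: symI)
  then have s: "sym (r\<^sup>*)" by (rule sym_rtrancl)
  obtain u v where uv: "h = component_of T u" "h' = component_of T v"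
    using assms by (auto simp: components_def)
  have "(u, x) \<in> r\<^sup>*" "(v, x) \<in> r\<^sup>*"
    using assms(3,4) by (auto simp: uv component_of_def induced_subgraph_def r_def)
  then have "(u, v) \<in> r\<^sup>*" "(v, u) \<in> r\<^sup>*" using s by (meson symD rtrancl_trans)+
  then have "(u, w) \<in> r\<^sup>* \<longleftrightarrow> (v, w) \<in> r\<^sup>*" for w by (meson rtrancl_trans)
  then show ?thesis by (simp add: uv component_of_def r_def)
qed

lemma components_cover: "(\<Union>h\<in>components T. verts h) = verts T"
  by (auto simp: components_def component_of_def induced_subgraph_def)

lemma embeds_glue:
  assumes f: "embeds f X F E A" and g: "embeds g Y F E B" and AB: "A \<inter> B = {}"
    and X: "X \<inter> Y = {}"
    and no: "\<And>u v. u \<in> X \<Longrightarrow> v \<in> Y \<Longrightarrow> {u, v} \<notin> F"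
    and noE: "\<And>u v. u \<in> A \<Longrightarrow> v \<in> B \<Longrightarrow> \<not> E u v \<and> \<not> E v u"
  shows "embeds (\<lambda>v. if v \<in> X then f v else g v) (X \<union> Y) F E (A \<union> B)"
proof -
  define h where "h v = (if v \<in> X then f v else g v)" for v
  have hX: "h v = f v" "h v \<in> A" if "v \<in> X" for v using that f by (auto simp: h_def embeds_def)
  have hY: "h v = g v" "h v \<in> B" if "v \<in> Y" for v using that X g by (auto simp: h_def embeds_def)
  have "inj_on h X" "inj_on h Y"
    using f g hX(1) hY(1) unfolding embeds_def by (metis inj_on_cong)+
  moreover have im: "h ` X \<subseteq> A" "h ` Y \<subseteq> B" using hX(2) hY(2) by (simp_all add: image_subset_iff)
  then have "h ` (X - Y) \<inter> h ` (Y - X) = {}" using AB by blast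
  ultimately have "inj_on h (X \<union> Y)" by (simp add: inj_on_Un)
  moreover have "h ` (X \<union> Y) \<subseteq> A \<union> B" using im by blast
  moreover have "{u, v} \<in> F \<longleftrightarrow> E (h u) (h v)" if uv: "u \<in> X \<union> Y" "v \<in> X \<union> Y" for u v
  proof -
    consider "u \<in> X" "v \<in> X" | "u \<in> X" "v \<in> Y" | "u \<in> Y" "v \<in> X" | "u \<in> Y" "v \<in> Y"
      using uv by blast
    then show ?thesis
    proof cases
      case 1
      then show ?thesis using f hX by (simp add: embeds_def)
    next
      case 2
      then show ?thesis using no noE[OF hX(2) hY(2)] by blast
    next
      case 3
      then show ?thesis using no[of v u] noE[OF hX(2) hY(2), of v u] by (simp add: insert_commute)
    next
      case 4
      then show ?thesis using g hY by (simp add: embeds_def)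
    qed
  qed
  ultimately have "embeds h (X \<union> Y) F E (A \<union> B)" by (simp only: embeds_def) simp
  then show ?thesis unfolding h_def .
qed

lemma embeds_mono: "embeds f X F E A \<Longrightarrow> A \<subseteq> B \<Longrightarrow> embeds f X F E B"
  unfolding embeds_def by blast

text \<open>The broom \<open>h\<close> is found together with a remainder \<open>Q\<close>
  anticomplete to it that is still not \<open>C * M\<close>-colourable, and the other components go
  into \<open>Q\<close>. The constant is chosen before \<open>E\<close>, \<open>V\<close>,
  \<open>M\<close> and \<open>W\<close>, because it is applied to \<open>Q\<close> here and to
  another value of \<open>M\<close> later.\<close>

lemma broom_forest_embeds:
  assumes T: "simple_graph T" and brooms: "\<forall>h\<in>components T. is_broom h"
    and "finite F" "F \<subseteq> components T"
  shows "\<exists>C. \<forall>(E :: 'a \<Rightarrow> 'a \<Rightarrow> bool) V M W. ramsey_graph E V s M \<longrightarrow> W \<subseteq> V \<longrightarrow>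
    \<not> rel_graph.col E W (C * M) \<longrightarrow> (\<exists>f. embeds f (\<Union>h\<in>F. verts h) (edges T) E W)"
  using assms(3,4)
proof (induction F rule: finite_induct)
  case empty
  then show ?case by (auto simp: embeds_def)
next
  case (insert h F)
  define Y where "Y = (\<Union>h\<in>F. verts h)"
  obtain C where C: "\<And>(E :: 'a \<Rightarrow> 'a \<Rightarrow> bool) V M W. ramsey_graph E V s M \<Longrightarrow> W \<subseteq> V \<Longrightarrow>
    \<not> rel_graph.col E W (C * M) \<Longrightarrow> (\<exists>f. embeds f Y (edges T) E W)"
    using insert.IH insert.prems unfolding Y_def by blast
  have h: "h \<in> components T" using insert by blast
  obtain k l where k: "k \<ge> 2" and iso: "graph_isomorphic h (broom k l)"
    using bspec[OF brooms h] by (auto simp: is_broom_def)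
  obtain i where i: "bij_betw i (verts h) (verts (broom k l))"
    "\<And>u v. u \<in> verts h \<Longrightarrow> v \<in> verts h \<Longrightarrow> {u, v} \<in> edges h \<longleftrightarrow> {i u, i v} \<in> edges (broom k l)"
    using iso by (auto simp: graph_isomorphic_def)
  have disj: "verts h \<inter> Y = {}"
  proof (rule ccontr)
    assume "\<not> ?thesis"
    then obtain h' x where "h' \<in> F" "x \<in> verts h" "x \<in> verts h'" by (auto simp: Y_def)
    then have "h = h'" using component_unique[OF h] insert.prems by blast
    then show False using insert.hyps \<open>h' \<in> F\<close> by blast
  qed
  have anti: "{u, v} \<notin> edges T" if "u \<in> verts h" "v \<in> Y" for u v
    using component_props(3)[OF T h that(1)] disj that(2) by blast
  have "\<exists>f. embeds f (verts h \<union> Y) (edges T) E W"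
    if R: "ramsey_graph E V s M" and W: "W \<subseteq> V" and nc: "\<not> rel_graph.col E W (broom_req s k l C * M)"
    for E :: "'a \<Rightarrow> 'a \<Rightarrow> bool" and V M W
  proof -
    interpret ramsey_graph E V s M by (rule R)
    obtain ys I Q where ys: "length ys = k" "ipath ys" "set ys \<subseteq> W" and I: "I \<subseteq> W" "stable I" "card I = l"
      "I \<inter> set ys = {}" "\<forall>w\<in>I. \<forall>y\<in>set ys. E w y \<longleftrightarrow> y = hd ys"
      and Q: "Q \<subseteq> W" "Q \<inter> (set ys \<union> I) = {}" "\<forall>u\<in>Q. \<forall>v\<in>set ys \<union> I. \<not> E u v" "\<not> col Q (C * M)"
      using broom_exists[OF W _ nc] k by auto
    have "finite I" using I(1) W finite_sub by blast
    then obtain g where g: "embeds g (verts (broom k l)) (edges (broom k l)) E (set ys \<union> I)"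
      using broom_embeds[OF k ys(1,2)] I by blast
    have "embeds (g \<circ> i) (verts h) (edges T) E (set ys \<union> I)"
    proof -
      have iv: "i u \<in> verts (broom k l)" if "u \<in> verts h" for u using i(1) that by (auto simp: bij_betw_def)
      have "inj_on (g \<circ> i) (verts h)"
        using i(1) g by (auto simp: bij_betw_def embeds_def intro: comp_inj_on)
      moreover have "{u, v} \<in> edges T \<longleftrightarrow> E (g (i u)) (g (i v))" if "u \<in> verts h" "v \<in> verts h" for u v
      proof -
        have "{u, v} \<in> edges T \<longleftrightarrow> {i u, i v} \<in> edges (broom k l)"
          using that i(2) component_props(2)[OF T h that] by simp
        also have "\<dots> \<longleftrightarrow> E (g (i u)) (g (i v))" using g that iv by (simp add: embeds_def)
        finally show ?thesis .
      qed
      moreover have "(g \<circ> i) ` verts h \<subseteq> set ys \<union> I"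
        using g iv by (simp add: embeds_def image_subset_iff)
      ultimately show ?thesis by (simp add: embeds_def)
    qed
    moreover obtain f where "embeds f Y (edges T) E Q"
      using C[OF R _ Q(4)] Q(1) W by blast
    ultimately have "embeds (\<lambda>v. if v \<in> verts h then (g \<circ> i) v else f v) (verts h \<union> Y) (edges T) E (set ys \<union> I \<union> Q)"
      by (rule embeds_glue) (use disj anti Q sym in blast)+
    then show ?thesis
      using embeds_mono ys(3) I(1) Q(1) by (metis Un_least)
  qed
  then show ?case by (intro exI[of _ "broom_req s k l C"]) (simp add: Y_def)
qed

section \<open>Complete multipartite subgraphs and the induction on \<open>m\<close>\<close>

context rel_graph begin

text \<open>The nested form fits the induction on \<open>m\<close>: if it fails for
  \<open>Suc m\<close>, then it fails for \<open>m\<close> in the common neighbourhood of each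
  stable \<open>s\<close>-set.\<close>

fun has_multipartite :: "nat \<Rightarrow> nat \<Rightarrow> 'a set \<Rightarrow> bool" where
  "has_multipartite s 0 W \<longleftrightarrow> True"
| "has_multipartite s (Suc m) W \<longleftrightarrow>
     (\<exists>S\<subseteq>W. card S = s \<and> stable S \<and> has_multipartite s m {u \<in> W. \<forall>v\<in>S. E v u})"

lemma multipartite_embeds:
  assumes "has_multipartite s m W" "1 \<le> s"
  shows "\<exists>f. inj_on f ({..<m} \<times> {..<s}) \<and> f ` ({..<m} \<times> {..<s}) \<subseteq> W \<and>
    (\<forall>p\<in>{..<m} \<times> {..<s}. \<forall>q\<in>{..<m} \<times> {..<s}. E (f p) (f q) \<longleftrightarrow> fst p \<noteq> fst q)"
  using assms(1)
proof (induction m arbitrary: W)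
  case 0
  then show ?case by simp
next
  case (Suc m)
  then obtain S where S: "S \<subseteq> W" "card S = s" "stable S"
    and mp: "has_multipartite s m {u \<in> W. \<forall>v\<in>S. E v u}" by auto
  obtain f where f: "inj_on f ({..<m} \<times> {..<s})"
    "f ` ({..<m} \<times> {..<s}) \<subseteq> {u \<in> W. \<forall>v\<in>S. E v u}"
    "\<forall>p\<in>{..<m} \<times> {..<s}. \<forall>q\<in>{..<m} \<times> {..<s}. E (f p) (f q) \<longleftrightarrow> fst p \<noteq> fst q"
    using Suc.IH[OF mp] by (elim exE conjE) (rule that)
  have "finite S" using S(2) assms(2) by (auto intro: card_ge_0_finite)
  then obtain g where g: "bij_betw g {..<s} S"
    using S(2) by (metis card_lessThan finite_lessThan finite_same_card_bij)
  define h where "h p = (if fst p = m then g (snd p) else f p)" for p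
  have old: "h p = f p \<and> E v (h p) \<and> E (h p) v \<and> h p \<in> W"
    if "p \<in> {..<m} \<times> {..<s}" "v \<in> S" for p v
    using that f(2) sym[of v "f p"] by (auto simp: h_def image_subset_iff)
  have new: "h (m, j) = g j \<and> h (m, j) \<in> S" if "j < s" for j
    using that g by (auto simp: h_def bij_betw_def)
  obtain v0 where v0: "v0 \<in> S" using new assms(2) by force
  have split: "p \<in> {..<m} \<times> {..<s} \<or> (\<exists>j<s. p = (m, j))" if "p \<in> {..<Suc m} \<times> {..<s}" for p
    using that by (cases p) auto
  have adj: "E (h p) (h q) \<longleftrightarrow> fst p \<noteq> fst q"
    if p: "p \<in> {..<Suc m} \<times> {..<s}" and q: "q \<in> {..<Suc m} \<times> {..<s}" for p q
  proof (cases "fst p = m"; cases "fst q = m")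
    assume "fst p = m" "fst q = m"
    then have "h p \<in> S" "h q \<in> S" using p q new by (metis mem_Times_iff lessThan_iff prod.collapse)+
    then show ?thesis using S(3) \<open>fst p = m\<close> \<open>fst q = m\<close> by (auto simp: stable_def)
  next
    assume a: "fst p = m" "fst q \<noteq> m"
    then have "h p \<in> S" using p new by (metis mem_Times_iff lessThan_iff prod.collapse)
    moreover have "q \<in> {..<m} \<times> {..<s}" using q a by auto
    ultimately show ?thesis using old a by metis
  next
    assume a: "fst p \<noteq> m" "fst q = m"
    then have "h q \<in> S" using q new by (metis mem_Times_iff lessThan_iff prod.collapse)
    moreover have "p \<in> {..<m} \<times> {..<s}" using p a by auto
    ultimately show ?thesis using old a by metis
  next
    assume a: "fst p \<noteq> m" "fst q \<noteq> m"
    then have "p \<in> {..<m} \<times> {..<s}" "q \<in> {..<m} \<times> {..<s}" using p q by auto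
    then show ?thesis using f(3) old v0 by metis
  qed
  have "inj_on h ({..<Suc m} \<times> {..<s})"
  proof (rule inj_onI)
    fix p q assume p: "p \<in> {..<Suc m} \<times> {..<s}" and q: "q \<in> {..<Suc m} \<times> {..<s}" and eq: "h p = h q"
    \<comment> \<open>Equal images are not adjacent, so by \<open>adj\<close> they come from the
      same part.\<close>
    have fst: "fst p = fst q" using adj[OF p q] eq irrefl by metis
    show "p = q"
    proof (cases "fst p = m")
      case True
      then have "g (snd p) = g (snd q)" using eq fst by (simp add: h_def)
      then have "snd p = snd q" using g p q by (auto simp: bij_betw_def inj_on_def)
      then show ?thesis using fst by (simp add: prod_eq_iff)
    next
      case False
      then have "p \<in> {..<m} \<times> {..<s}" "q \<in> {..<m} \<times> {..<s}" using p q fst by auto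
      moreover have "f p = f q" using eq False fst by (simp add: h_def)
      ultimately show ?thesis using f(1) by (meson inj_onD)
    qed
  qed
  moreover have "h ` ({..<Suc m} \<times> {..<s}) \<subseteq> W"
  proof
    fix w assume "w \<in> h ` ({..<Suc m} \<times> {..<s})"
    then obtain p where "p \<in> {..<Suc m} \<times> {..<s}" "w = h p" by blast
    then show "w \<in> W" using split[of p] old[OF _ v0] new S(1) by blast
  qed
  ultimately show ?case using adj by (intro exI[of _ h]) blast
qed

end

text \<open>By induction the common neighbourhood of a stable \<open>s\<close>-set is
  \<open>C * M\<close>-colourable, which gives \<open>common\<close>, so forests of brooms can be
  embedded with \<open>Suc C * M\<close> in place of \<open>M\<close>. For \<open>m = 0\<close> the
  hypotheses are contradictory.\<close>

lemma col_if_no_multipartite: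
  assumes T: "simple_graph T" and brooms: "\<forall>h\<in>components T. is_broom h" and s: "1 \<le> s"
  shows "\<exists>C. \<forall>(E :: 'a \<Rightarrow> 'a \<Rightarrow> bool) V M. rel_graph E \<longrightarrow> finite V \<longrightarrow> 1 \<le> M \<longrightarrow>
    (\<forall>W\<subseteq>V. M \<le> card W \<longrightarrow> (\<exists>S\<subseteq>W. card S = s \<and> rel_graph.stable E S)) \<longrightarrow>
    \<not> (\<exists>f. embeds f (verts T) (edges T) E V) \<longrightarrow> \<not> rel_graph.has_multipartite E s m V \<longrightarrow>
    rel_graph.col E V (C * M)"
proof (induction m)
  case 0
  then show ?case by (simp add: rel_graph.has_multipartite.simps)
next
  case (Suc m)
  obtain C where C: "\<And>(E :: 'a \<Rightarrow> 'a \<Rightarrow> bool) V M. rel_graph E \<Longrightarrow> finite V \<Longrightarrow> 1 \<le> M \<Longrightarrow>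
    (\<forall>W\<subseteq>V. M \<le> card W \<longrightarrow> (\<exists>S\<subseteq>W. card S = s \<and> rel_graph.stable E S)) \<Longrightarrow>
    \<not> (\<exists>f. embeds f (verts T) (edges T) E V) \<Longrightarrow> \<not> rel_graph.has_multipartite E s m V \<Longrightarrow>
    rel_graph.col E V (C * M)"
    using Suc by blast
  have "finite (components T)" using T by (simp add: components_def simple_graph_def)
  then obtain D where D: "\<And>(E :: 'a \<Rightarrow> 'a \<Rightarrow> bool) V M W. ramsey_graph E V s M \<Longrightarrow> W \<subseteq> V \<Longrightarrow>
    \<not> rel_graph.col E W (D * M) \<Longrightarrow> (\<exists>f. embeds f (verts T) (edges T) E W)"
    using broom_forest_embeds[OF T brooms _ order_refl, where ?'a = 'a and s = s]
    unfolding components_cover by blast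
  have "rel_graph.col E V (D * Suc C * M)"
    if E: "rel_graph E" and V: "finite V" "1 \<le> M"
      and R: "\<forall>W\<subseteq>V. M \<le> card W \<longrightarrow> (\<exists>S\<subseteq>W. card S = s \<and> rel_graph.stable E S)"
      and noT: "\<not> (\<exists>f. embeds f (verts T) (edges T) E V)"
      and no: "\<not> rel_graph.has_multipartite E s (Suc m) V"
    for E :: "'a \<Rightarrow> 'a \<Rightarrow> bool" and V M
  proof -
    interpret rel_graph E by (rule E)
    \<comment> \<open>\<open>Suc C\<close> instead of \<open>C\<close> keeps the parameter at least
      \<open>M\<close>, as \<open>large\<close> needs, even when \<open>C = 0\<close>.\<close>
    have "ramsey_graph E V s (Suc C * M)"
    proof unfold_locales
      show "finite V" "1 \<le> s" "1 \<le> Suc C * M" using V s by auto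
      show "\<exists>S\<subseteq>W. card S = s \<and> stable S" if "W \<subseteq> V" "Suc C * M \<le> card W" for W
        using that R by auto
      show "col {u \<in> V. \<forall>v\<in>S. E v u} (Suc C * M)" if S: "S \<subseteq> V" "card S = s" "stable S" for S
      proof -
        define N where "N = {u \<in> V. \<forall>v\<in>S. E v u}"
        have NV: "N \<subseteq> V" by (auto simp: N_def)
        have "col N (C * M)"
        proof (rule C[OF E _ V(2)])
          show "finite N" using NV V(1) finite_subset by blast
          show "\<forall>W\<subseteq>N. M \<le> card W \<longrightarrow> (\<exists>S\<subseteq>W. card S = s \<and> stable S)" using R NV by blast
          show "\<nexists>f. embeds f (verts T) (edges T) E N" using noT embeds_mono[OF _ NV] by blast
          show "\<not> has_multipartite s m N" using no S by (auto simp: N_def)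
        qed
        then show ?thesis using col_mono[of N "C * M" N "Suc C * M"] by (simp add: N_def)
      qed
    qed
    then have "col V (D * (Suc C * M))" using D[of E V "Suc C * M" V] noT by blast
    then show ?thesis by (simp only: mult.assoc)
  qed
  then show ?case by blast
qed

section \<open>Transfer to the graph and Ramsey number definitions\<close>

lemma not_free_if_embeds:
  assumes f: "embeds f (verts H) (edges H) (\<lambda>u v. {u, v} \<in> edges G) (verts G)"
  shows "\<not> free_of G H"
proof -
  define S where "S = f ` verts H"
  have "bij_betw f (verts H) S" using f by (simp add: embeds_def S_def bij_betw_def)
  then have bij: "bij_betw (inv_into (verts H) f) S (verts H)" by (rule bij_betw_inv_into)
  have fi: "inv_into (verts H) f u \<in> verts H \<and> f (inv_into (verts H) f u) = u" if "u \<in> S" for u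
    using that by (auto simp: S_def f_inv_into_f inv_into_into)
  have "{u, v} \<in> edges (induced_subgraph G S) \<longleftrightarrow> {inv_into (verts H) f u, inv_into (verts H) f v} \<in> edges H"
    if u: "u \<in> S" and v: "v \<in> S" for u v
  proof -
    have "{inv_into (verts H) f u, inv_into (verts H) f v} \<in> edges H \<longleftrightarrow> {u, v} \<in> edges G"
      using f fi[OF u] fi[OF v] unfolding embeds_def by metis
    then show ?thesis using u v by (simp add: induced_subgraph_def)
  qed
  then have "graph_isomorphic (induced_subgraph G S) H"
    unfolding graph_isomorphic_def using bij
    by (intro exI[of _ "inv_into (verts H) f"]) (simp add: induced_subgraph_def)
  moreover have "S \<subseteq> verts G" using f by (auto simp: S_def embeds_def)
  ultimately show ?thesis by (auto simp: free_of_def)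
qed

lemma edges_complement_copies:
  assumes "p \<in> {..<m} \<times> {..<s}" "q \<in> {..<m} \<times> {..<s}"
  shows "{p, q} \<in> edges (complement (copies_complete m s)) \<longleftrightarrow> fst p \<noteq> fst q"
proof (cases "p = q")
  case True
  then show ?thesis by (auto simp: complement_def nsets_def)
next
  case False
  have "(\<exists>i<m. {p, q} \<in> nsets ({i} \<times> {..<s}) 2) \<longleftrightarrow> fst p = fst q"
    using assms False by (auto simp: nsets_def)
  moreover have "{p, q} \<in> nsets ({..<m} \<times> {..<s}) 2" using assms False by (simp add: nsets_def)
  ultimately show ?thesis by (simp add: complement_def copies_complete_def) blast
qed

text \<open>The finite Ramsey theorem provides some number of this kind, so the \<open>LEAST\<close>
  in the definition is attained.\<close>

lemma ramsey_number_property: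
  "ramsey_number s w \<ge> 1 \<and>
    (\<forall>G :: nat graph. simple_graph G \<and> card (verts G) = ramsey_number s w \<longrightarrow>
        (\<exists>S \<subseteq> verts G. card S = s \<and> indep S (edges G)) \<or>
        (\<exists>K \<subseteq> verts G. card K = w \<and> clique K (edges G)))"
proof -
  obtain r where r: "r \<ge> 1" "\<forall>(V :: nat set) (E :: nat set set). finite V \<and> card V \<ge> r \<longrightarrow>
    (\<exists>R \<subseteq> V. card R = w \<and> clique R E \<or> card R = s \<and> indep R E)"
    using ramsey2[of w s, where ?'a = nat] by blast
  show ?thesis unfolding ramsey_number_def
  proof (rule LeastI[of _ r], intro conjI allI impI r(1))
    fix G :: "nat graph" assume "simple_graph G \<and> card (verts G) = r"
    then obtain R where "R \<subseteq> verts G" "card R = w \<and> clique R (edges G) \<or> card R = s \<and> indep R (edges G)"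
      using r(2)[rule_format, of "verts G" "edges G"] by (auto simp: simple_graph_def)
    then show "(\<exists>S \<subseteq> verts G. card S = s \<and> indep S (edges G)) \<or>
        (\<exists>K \<subseteq> verts G. card K = w \<and> clique K (edges G))" by blast
  qed
qed

text \<open>\<open>ramsey_number\<close> speaks of graphs on natural numbers with exactly that many
  vertices, so a subset of this size is chosen and its induced graph is pulled back along a
  bijection.\<close>

lemma ramsey_number_subset:
  fixes G :: "'a graph"
  assumes G: "simple_graph G" and W: "W \<subseteq> verts G" "ramsey_number s w \<le> card W"
  shows "(\<exists>S\<subseteq>W. card S = s \<and> indep S (edges G)) \<or> (\<exists>K\<subseteq>W. card K = w \<and> clique K (edges G))"
proof -
  obtain W' where W': "W' \<subseteq> W" "card W' = ramsey_number s w"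
    by (rule obtain_subset_with_card_n[OF W(2)]) (rule that)
  have "finite W'" using W' W G by (meson finite_subset simple_graph_def)
  then obtain h where h: "bij_betw h {0..<ramsey_number s w} W'"
    using ex_bij_betw_nat_finite W'(2) by metis
  define H where "H = Graph {0..<ramsey_number s w} {{i, j} |i j. i < ramsey_number s w \<and> j < ramsey_number s w \<and> {h i, h j} \<in> edges G}"
  \<comment> \<open>For \<open>i = j\<close> the pair \<open>{h i, h j}\<close> is a singleton and
    hence not an edge, so \<open>H\<close> has no loops.\<close>
  have ne: "{u} \<notin> edges G" for u
    using G by (auto simp: simple_graph_def nsets_def)
  have H: "simple_graph H" "card (verts H) = ramsey_number s w"
    using ne by (auto simp: simple_graph_def H_def nsets_def card_insert_if)
  have edge: "{i, j} \<in> edges H \<longleftrightarrow> {h i, h j} \<in> edges G" if "i \<in> verts H" "j \<in> verts H" for i j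
    using that by (auto simp: H_def doubleton_eq_iff insert_commute)
  have inj: "inj_on h (verts H)" and im: "h ` verts H = W'" using h by (auto simp: H_def bij_betw_def)
  have tr: "h ` X \<subseteq> W \<and> card (h ` X) = card X" if "X \<subseteq> verts H" for X
    using that inj im W'(1) by (auto intro: card_image inj_on_subset)
  consider S where "S \<subseteq> verts H" "card S = s" "indep S (edges H)" |
    K where "K \<subseteq> verts H" "card K = w" "clique K (edges H)"
    using ramsey_number_property[of s w] H by blast
  then show ?thesis
  proof cases
    case 1
    have "indep (h ` S) (edges G)" unfolding indep_def
    proof (intro ballI impI)
      fix u v assume "u \<in> h ` S" "v \<in> h ` S" "u \<noteq> v"
      then obtain i j where ij: "i \<in> S" "j \<in> S" "i \<noteq> j" "u = h i" "v = h j" by blast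
      then have "{i, j} \<notin> edges H" using 1(3) by (simp add: indep_def)
      then show "{u, v} \<notin> edges G" using edge[of i j] ij 1(1) by blast
    qed
    then show ?thesis using tr 1 by (intro disjI1 exI[of _ "h ` S"]) auto
  next
    case 2
    have "clique (h ` K) (edges G)" unfolding clique_def
    proof (intro ballI impI)
      fix u v assume "u \<in> h ` K" "v \<in> h ` K" "u \<noteq> v"
      then obtain i j where ij: "i \<in> K" "j \<in> K" "i \<noteq> j" "u = h i" "v = h j" by blast
      then have "{i, j} \<in> edges H" using 2(3) by (simp add: clique_def)
      then show "{u, v} \<in> edges G" using edge[of i j] ij 2(1) by blast
    qed
    then show ?thesis using tr 2 by (intro disjI2 exI[of _ "h ` K"]) auto
  qed
qed


theorem theorem1p6:
  fixes T :: "'b graph" and m s :: nat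
  assumes "m \<ge> 1" and "s \<ge> 2"
    and "forest T" and "\<forall>H \<in> components T. is_broom H"
  shows "\<exists>C::real. C \<ge> 1 \<and>
           (\<forall>G :: 'a graph. simple_graph G \<and> free_of G T \<and>
              free_of G (complement (copies_complete m s)) \<longrightarrow>
              real (chromatic_number G) \<le> C * real (ramsey_number s (clique_number G + 1)))"
proof -
  have T: "simple_graph T" using assms(3) by (simp add: forest_def)
  have s: "1 \<le> s" using assms(2) by simp
  obtain C where C: "\<forall>(E :: 'a \<Rightarrow> 'a \<Rightarrow> bool) V M. rel_graph E \<longrightarrow> finite V \<longrightarrow> 1 \<le> M \<longrightarrow>
    (\<forall>W\<subseteq>V. M \<le> card W \<longrightarrow> (\<exists>S\<subseteq>W. card S = s \<and> rel_graph.stable E S)) \<longrightarrow>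
    \<not> (\<exists>f. embeds f (verts T) (edges T) E V) \<longrightarrow> \<not> rel_graph.has_multipartite E s m V \<longrightarrow>
    rel_graph.col E V (C * M)"
    using col_if_no_multipartite[OF T assms(4) s, where ?'a = 'a and m = m]
    by (elim exE) (rule that)
  have main: "chromatic_number G \<le> C * ramsey_number s (clique_number G + 1)"
    if G: "simple_graph G" and noT: "free_of G T"
      and noK: "free_of G (complement (copies_complete m s))" for G :: "'a graph"
  proof -
    define E where "E u v \<longleftrightarrow> {u, v} \<in> edges G" for u v
    have finV: "finite (verts G)" using G by (simp add: simple_graph_def)
    interpret rel_graph E
    proof
      show "E v u" if "E u v" for u v using that by (simp add: E_def insert_commute)
      show "\<not> E u u" for u using G by (auto simp: E_def simple_graph_def nsets_def)
    qed
    \<comment> \<open>The other Ramsey outcome would be a clique larger than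
      \<open>clique_number G\<close>.\<close>
    have R: "\<exists>S\<subseteq>W. card S = s \<and> stable S"
      if W: "W \<subseteq> verts G" "ramsey_number s (clique_number G + 1) \<le> card W" for W
    proof -
      have "False" if K: "K \<subseteq> W" "card K = clique_number G + 1" "clique K (edges G)" for K
      proof -
        have "finite {card K |K. K \<subseteq> verts G \<and> clique K (edges G)}"
          by (rule finite_subset[of _ "card ` Pow (verts G)"]) (use finV in auto)
        then have "card K \<le> clique_number G"
          unfolding clique_number_def by (rule Max_ge) (use K W in blast)
        then show False using K by simp
      qed
      then obtain S where S: "S \<subseteq> W" "card S = s" "indep S (edges G)"
        using ramsey_number_subset[OF G W] by blast
      then have "stable S" using irrefl unfolding stable_def indep_def E_def by metis
      then show ?thesis using S by blast
    qed
    have "\<not> (\<exists>f. embeds f (verts T) (edges T) E (verts G))"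
      using not_free_if_embeds noT unfolding E_def by blast
    moreover have "\<not> has_multipartite s m (verts G)"
    proof
      assume "has_multipartite s m (verts G)"
      then obtain f where "inj_on f ({..<m} \<times> {..<s})" "f ` ({..<m} \<times> {..<s}) \<subseteq> verts G"
        "\<forall>p\<in>{..<m} \<times> {..<s}. \<forall>q\<in>{..<m} \<times> {..<s}. E (f p) (f q) \<longleftrightarrow> fst p \<noteq> fst q"
        using multipartite_embeds[OF _ s] by blast
      moreover have "verts (complement (copies_complete m s)) = {..<m} \<times> {..<s}"
        by (simp add: complement_def copies_complete_def)
      ultimately have "embeds f (verts (complement (copies_complete m s)))
          (edges (complement (copies_complete m s))) (\<lambda>u v. {u, v} \<in> edges G) (verts G)"
        by (simp add: embeds_def edges_complement_copies E_def)
      then show False using not_free_if_embeds noK by blast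
    qed
    ultimately have "col (verts G) (C * ramsey_number s (clique_number G + 1))"
      using C[rule_format, OF rel_graph_axioms finV, of "ramsey_number s (clique_number G + 1)"] R
        ramsey_number_property by blast
    then obtain c where "proper (verts G) (C * ramsey_number s (clique_number G + 1)) c"
      by (auto simp: col_def)
    moreover have "u \<in> verts G \<and> v \<in> verts G" if "{u, v} \<in> edges G" for u v
      using that G by (auto simp: simple_graph_def nsets_def)
    ultimately have "proper_colouring G (C * ramsey_number s (clique_number G + 1)) c"
      by (auto simp: proper_def proper_colouring_def E_def)
    then show ?thesis unfolding chromatic_number_def by (intro Least_le) blast
  qed
  \<comment> \<open>The natural number \<open>C\<close> may be \<open>0\<close>, whereas a constant
    of at least \<open>1\<close> is wanted.\<close>
  have "real (chromatic_number G) \<le> max 1 (real C) * real (ramsey_number s (clique_number G + 1))"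
    if "simple_graph G" "free_of G T" "free_of G (complement (copies_complete m s))" for G :: "'a graph"
  proof -
    have "real (chromatic_number G) \<le> real C * real (ramsey_number s (clique_number G + 1))"
      using main[OF that] by (metis of_nat_le_iff of_nat_mult)
    also have "\<dots> \<le> max 1 (real C) * real (ramsey_number s (clique_number G + 1))"
      by (intro mult_right_mono) auto
    finally show ?thesis .
  qed
  then show ?thesis by (intro exI[of _ "max 1 (real C)"]) auto
qed

end
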